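(* Let $\Phi$ be a simple, stationary, weakly sub-Poisson point process on $\mathbb{R}^d$ of intensity $\lambda$. For every integer $k\ge 1$ and every $\lambda>0$ there exist constants $c(\lambda)$ and $c(\lambda,k)$, not depending on the distribution of $\Phi$ (that is, the same constants serve for all such $\Phi$ of intensity $\lambda$), such that $$0<c(\lambda)\le r_c^1(\Phi)\le r_c^k(\Phi)\le c(\lambda,k)<\infty .$$
   Context: A point process $\Phi$ on the $d$-dimensional Euclidean space $\mathbb{R}^d$ is a random element of the space of Radon (locally finite) counting measures on $\mathbb{R}^d$; we write $X\in\Phi$ for its points (atoms, counted with multiplicity). It is simple if almost surely $\Phi(\{x\})\le 1$ for all $x\in\mathbb{R}^d$; stationary if its law is invariant under all translations of $\mathbb{R}^d$. A stationary process has intensity $\lambda$ ($0<\lambda<\infty$) if $\mathsf{E}(\Phi(B))=\lambda\|B\|$ for all Borel $B$, where $\|\cdot\|$ is Lebesgue measure. "bBs" means bounded Borel subset of $\mathbb{R}^d$. $\Phi$ is $\nu$-weakly sub-Poisson if $\mathsf{P}(\Phi(B)=0)\le e^{-\mathsf{E}(\Phi(B))}$ for every bBs $B$. $\Phi$ is $\alpha$-weakly sub-Poisson if $\mathsf{E}\big(\prod_{i=1}^n\Phi(B_i)\big)\le\prod_{i=1}^n\mathsf{E}(\Phi(B_i))$ for every $n\ge1$ and all mutually disjoint bBs $B_1,\dots,B_n$. $\Phi$ is weakly sub-Poisson if it is both $\nu$-weakly and $\alpha$-weakly sub-Poisson. For $r\ge 0$ and integer $k\ge 1$ let $B_r(x)$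 be the Euclidean ball of radius $r$ centred at $x$, let $V_{\Phi,r}(y):=\sum_{X_i\in\Phi}\mathbf{1}[y\in B_r(X_i)]$, and let $C_k(\Phi,r):=\{y: V_{\Phi,r}(y)\ge k\}$ be the $k$-covered set. A subset of $\mathbb{R}^d$ percolates if it contains an unbounded connected subset. The critical radius for $k$-percolation is $r_c^k(\Phi):=\inf\{r:\mathsf{P}(C_k(\Phi,r)\text{ percolates})>0\}$.
   Formalization: Dimension d ≥ 2 is assumed: for d = 1 the claim fails, since the stationary Poisson process on the line is weakly sub-Poisson with r_c^1 = ∞. Constants serve all processes on one sample space, which may be the configuration space, where every distribution of Φ is realised. *)

theory Defs
  imports "HOL-Probability.Probability"
begin

section \<open>Radon counting measures\<close>

definition radon_counting_measures :: "'a::euclidean_space measure set" where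
  "radon_counting_measures =
     {\<mu>. sets \<mu> = sets borel
        \<and> (\<forall>B\<in>sets borel. emeasure \<mu> B \<in> range of_nat \<union> {\<infinity>})
        \<and> (\<forall>B\<in>sets borel. bounded B \<longrightarrow> emeasure \<mu> B < \<infinity>)}"

text \<open>The space of Radon counting measures carries the \<open>\<sigma>\<close>-algebra generated by the
  evaluations \<open>\<mu> \<mapsto> \<mu>(B)\<close>.\<close>

definition counting_space :: "'a::euclidean_space measure measure" where
  "counting_space = sigma radon_counting_measures
     {{\<mu> \<in> radon_counting_measures. emeasure \<mu> B \<in> A} | B A. B \<in> sets borel \<and> A \<in> sets borel}"

definition translate :: "'a::euclidean_space \<Rightarrow> 'a measure \<Rightarrow> 'a measure" where
  "translate a \<mu> = distr \<mu> borel (\<lambda>x. x + a)"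

lemma sets_translate [simp]: "sets (translate a \<mu>) = sets borel"
  by (simp add: translate_def)

lemma space_counting_space: "space counting_space = radon_counting_measures"
  unfolding counting_space_def by (rule space_measure_of) auto

lemma measurable_emeasure_counting_space:
  assumes "B \<in> sets borel"
  shows "(\<lambda>\<mu>. emeasure \<mu> B) \<in> borel_measurable counting_space"
proof (rule measurableI)
  fix A :: "ennreal set" assume A: "A \<in> sets borel"
  have "{\<mu> \<in> radon_counting_measures. emeasure \<mu> B \<in> A} \<in> sets counting_space"
    unfolding counting_space_def using assms A
    by (subst sets_measure_of) (auto intro!: sigma_sets.Basic)
  then show "(\<lambda>\<mu>. emeasure \<mu> B) -` A \<inter> space counting_space \<in> sets counting_space"
    by (simp add: space_counting_space vimage_def Int_def conj_commute)
qed auto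

lemma measurable_counting_space_iff:
  "\<Phi> \<in> measurable M counting_space \<longleftrightarrow>
     (\<forall>\<omega>\<in>space M. \<Phi> \<omega> \<in> radon_counting_measures)
     \<and> (\<forall>B\<in>sets borel. (\<lambda>\<omega>. emeasure (\<Phi> \<omega>) B) \<in> borel_measurable M)"
  (is "?L \<longleftrightarrow> ?R")
proof
  assume L: ?L
  show ?R
    using measurable_space[OF L] measurable_compose[OF L measurable_emeasure_counting_space]
    by (auto simp: space_counting_space)
next
  assume R: ?R
  show ?L
    unfolding counting_space_def
  proof (rule measurable_measure_of)
    fix Y assume "Y \<in> {{\<mu> \<in> radon_counting_measures. emeasure \<mu> B \<in> A} |
                         B A. B \<in> sets (borel :: 'b measure) \<and> A \<in> sets borel}"
    then obtain B A where Y: "Y = {\<mu> \<in> radon_counting_measures. emeasure \<mu> B \<in> A}"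
      and B: "B \<in> sets borel" and A: "A \<in> sets borel" by auto
    have "\<Phi> -` Y \<inter> space M = (\<lambda>\<omega>. emeasure (\<Phi> \<omega>) B) -` A \<inter> space M"
      using R Y by auto
    also have "\<dots> \<in> sets M"
      using R A B by (auto intro: measurable_sets)
    finally show "\<Phi> -` Y \<inter> space M \<in> sets M" .
  qed (use R in auto)
qed

lemma measurable_translate: "translate a \<in> measurable counting_space counting_space"
proof -
  have e: "emeasure (translate a \<mu>) B = emeasure \<mu> ((\<lambda>x. x + a) -` B)"
    and b: "(\<lambda>x. x + a) -` B \<in> sets borel"
    if "\<mu> \<in> radon_counting_measures" "B \<in> sets borel" for \<mu> :: "'a measure" and B
  proof -
    have s: "sets \<mu> = sets borel" using that by (simp add: radon_counting_measures_def)
    have m: "(\<lambda>x. x + a) \<in> borel_measurable \<mu>"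
      by (subst measurable_cong_sets[OF s refl]) measurable
    show "emeasure (translate a \<mu>) B = emeasure \<mu> ((\<lambda>x. x + a) -` B)"
      unfolding translate_def using that m sets_eq_imp_space_eq[OF s] by (simp add: emeasure_distr)
    have "(\<lambda>x. x + a) -` B \<inter> space (borel::'a measure) \<in> sets borel"
      by (rule measurable_sets[of _ _ borel]) (use that in auto)
    then show "(\<lambda>x. x + a) -` B \<in> sets borel" by simp
  qed
  have bd: "bounded ((\<lambda>x. x + a) -` B)" if "bounded B" for B :: "'a set"
  proof -
    have "(\<lambda>x. x + a) -` B \<subseteq> (\<lambda>x. - a + x) ` B"
    proof
      fix x assume "x \<in> (\<lambda>x. x + a) -` B"
      then show "x \<in> (\<lambda>x. - a + x) ` B" by (intro image_eqI[of _ _ "x + a"]) auto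
    qed
    then show ?thesis using bounded_subset[OF bounded_translation[OF that]] by blast
  qed
  show ?thesis
    unfolding measurable_counting_space_iff
  proof (intro conjI ballI)
    fix \<mu> :: "'a measure" assume "\<mu> \<in> space counting_space"
    then have \<mu>: "\<mu> \<in> radon_counting_measures" by (simp add: space_counting_space)
    show "translate a \<mu> \<in> radon_counting_measures"
      unfolding radon_counting_measures_def
      using \<mu> e[OF \<mu>] b[OF \<mu>] bd
      by (auto simp: sets_translate radon_counting_measures_def)
  next
    fix B :: "'a set" assume B: "B \<in> sets borel"
    have B': "(\<lambda>x. x + a) -` B \<in> sets borel"
      using measurable_sets[of "\<lambda>x. x + a" borel borel B] B by simp
    have "(\<lambda>\<mu>. emeasure (translate a \<mu>) B) \<in> borel_measurable counting_space \<longleftrightarrow>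
          (\<lambda>\<mu>. emeasure \<mu> ((\<lambda>x. x + a) -` B)) \<in> borel_measurable counting_space"
      by (rule measurable_cong) (simp add: e B space_counting_space)
    then show "(\<lambda>\<mu>. emeasure (translate a \<mu>) B) \<in> borel_measurable counting_space"
      using measurable_emeasure_counting_space[OF B'] by simp
  qed
qed


section \<open>Point processes\<close>

definition point_process :: "'w measure \<Rightarrow> ('w \<Rightarrow> 'a::euclidean_space measure) \<Rightarrow> bool" where
  "point_process M \<Phi> \<longleftrightarrow> prob_space M \<and> \<Phi> \<in> measurable M counting_space"

definition simple_pp :: "'w measure \<Rightarrow> ('w \<Rightarrow> 'a::euclidean_space measure) \<Rightarrow> bool" where
  "simple_pp M \<Phi> \<longleftrightarrow> (AE \<omega> in M. \<forall>x. emeasure (\<Phi> \<omega>) {x} \<le> 1)"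

definition stationary_pp :: "'w measure \<Rightarrow> ('w \<Rightarrow> 'a::euclidean_space measure) \<Rightarrow> bool" where
  "stationary_pp M \<Phi> \<longleftrightarrow>
     (\<forall>a. distr M counting_space (\<lambda>\<omega>. translate a (\<Phi> \<omega>)) = distr M counting_space \<Phi>)"

definition mean_count :: "'w measure \<Rightarrow> ('w \<Rightarrow> 'a::euclidean_space measure) \<Rightarrow> 'a set \<Rightarrow> ennreal" where
  "mean_count M \<Phi> B = (\<integral>\<^sup>+\<omega>. emeasure (\<Phi> \<omega>) B \<partial>M)"

definition has_intensity :: "'w measure \<Rightarrow> ('w \<Rightarrow> 'a::euclidean_space measure) \<Rightarrow> real \<Rightarrow> bool" where
  "has_intensity M \<Phi> l \<longleftrightarrow>
     0 < l \<and> (\<forall>B\<in>sets borel. mean_count M \<Phi> B = ennreal l * emeasure lborel B)"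

definition exp_neg :: "ennreal \<Rightarrow> real" where
  "exp_neg t = (if t = \<infinity> then 0 else exp (- enn2real t))"

definition nu_weakly_sub_poisson :: "'w measure \<Rightarrow> ('w \<Rightarrow> 'a::euclidean_space measure) \<Rightarrow> bool" where
  "nu_weakly_sub_poisson M \<Phi> \<longleftrightarrow>
     (\<forall>B\<in>sets borel. bounded B \<longrightarrow>
        measure M {\<omega> \<in> space M. emeasure (\<Phi> \<omega>) B = 0} \<le> exp_neg (mean_count M \<Phi> B))"

definition alpha_weakly_sub_poisson :: "'w measure \<Rightarrow> ('w \<Rightarrow> 'a::euclidean_space measure) \<Rightarrow> bool" where
  "alpha_weakly_sub_poisson M \<Phi> \<longleftrightarrow>
     (\<forall>n\<ge>1. \<forall>B :: nat \<Rightarrow> 'a set.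
        (\<forall>i\<in>{1..n}. B i \<in> sets borel \<and> bounded (B i)) \<and> disjoint_family_on B {1..n} \<longrightarrow>
        (\<integral>\<^sup>+\<omega>. (\<Prod>i\<in>{1..n}. emeasure (\<Phi> \<omega>) (B i)) \<partial>M) \<le> (\<Prod>i\<in>{1..n}. mean_count M \<Phi> (B i)))"

definition weakly_sub_poisson :: "'w measure \<Rightarrow> ('w \<Rightarrow> 'a::euclidean_space measure) \<Rightarrow> bool" where
  "weakly_sub_poisson M \<Phi> \<longleftrightarrow> nu_weakly_sub_poisson M \<Phi> \<and> alpha_weakly_sub_poisson M \<Phi>"


section \<open>Coverage and percolation\<close>

text \<open>The sum over the points of a configuration, counted with multiplicity: an atom \<open>x\<close>
  contributes \<open>\<mu>({x})\<close> times. Balls are closed.\<close>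

definition coverage :: "'a::euclidean_space measure \<Rightarrow> real \<Rightarrow> 'a \<Rightarrow> ennreal" where
  "coverage \<mu> r y =
     (\<Sum>\<^sub>\<infinity>x\<in>{x. emeasure \<mu> {x} \<noteq> 0}. emeasure \<mu> {x} * indicator (cball x r) y)"

definition covered_set :: "nat \<Rightarrow> 'a::euclidean_space measure \<Rightarrow> real \<Rightarrow> 'a set" where
  "covered_set k \<mu> r = {y. of_nat k \<le> coverage \<mu> r y}"

definition percolates :: "'a::euclidean_space set \<Rightarrow> bool" where
  "percolates A \<longleftrightarrow> (\<exists>S\<subseteq>A. connected S \<and> \<not> bounded S)"

text \<open>Extended-real valued, so that it is \<open>\<infinity>\<close> when no radius percolates.\<close>

definition critical_radius ::
  "nat \<Rightarrow> 'w measure \<Rightarrow> ('w \<Rightarrow> 'a::euclidean_space measure) \<Rightarrow> ereal" where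
  "critical_radius k M \<Phi> =
     Inf {ereal r | r. 0 \<le> r \<and>
       0 < measure M {\<omega> \<in> space M. percolates (covered_set k (\<Phi> \<omega>) r)}}"

end

theory Submission imports Defs begin

text \<open>
  Lower bound: partition the space into cubes of side \<open>s > 2 r\<close>. An unbounded connected subset of the
  union of the balls visits arbitrarily long self-avoiding paths of occupied, mutually adjacent cubes
  starting from one fixed cube. There are at most \<open>K\<^sup>n\<close> paths of length \<open>n\<close>, and by \<open>\<alpha>\<close>-weak
  sub-Poissonianity and Markov's inequality each is occupied with probability at most \<open>(\<lambda> s\<^sup>d)\<^sup>n\<close>,
  so for small \<open>s\<close> no such family exists almost surely.

  Upper bound: split off \<open>k\<close> fine cubes of side \<open>u\<close> in each coarse cube of side \<open>k u\<close> and call the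
  coarse cube good if all of them are occupied. If the good cubes do not percolate, the outer boundary
  of the cluster of the origin is connected and covered by bad cubes (Peierls), and hence for some
  \<open>m\<close> there is a path of \<open>m + 1\<close> bad cubes starting at distance \<open>m\<close> on a half-axis. By
  \<open>\<nu>\<close>-weak sub-Poissonianity this has probability at most
  \<open>\<Sum>m. (K k exp (- \<lambda> u\<^sup>d))\<^bsup>m+1\<^esup> < 1\<close> for large \<open>u\<close>.
\<close>

section \<open>Integer-valued measures are purely atomic; coverage as the mass of a ball\<close>

section \<open>Radon counting measures\<close>

lemma radon_counting_measures_sets:
  "\<mu> \<in> radon_counting_measures \<Longrightarrow> sets \<mu> = sets borel"
  by (simp add: radon_counting_measures_def)

text \<open>The gap between 0 and 1 turns "occupied" into a lower bound on mass. It serves Markov's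
  inequality in the subcritical regime and the count of \<open>k\<close> points in a good
  cell.\<close>

lemma radon_counting_measures_nat:
  assumes "\<mu> \<in> radon_counting_measures" "B \<in> sets borel"
  shows "emeasure \<mu> B = 0 \<or> 1 \<le> emeasure \<mu> B"
proof -
  have "emeasure \<mu> B \<in> range of_nat \<union> {\<infinity>}"
    using assms by (auto simp: radon_counting_measures_def)
  then consider n where "emeasure \<mu> B = of_nat n" | "emeasure \<mu> B = \<infinity>" by auto
  then show ?thesis
  proof cases
    case 1
    then show ?thesis by (cases n) (auto simp: add_increasing2)
  qed auto
qed

lemma point_process_radon:
  "point_process M \<Phi> \<Longrightarrow> \<omega> \<in> space M \<Longrightarrow> \<Phi> \<omega> \<in> radon_counting_measures"
  by (auto simp: point_process_def measurable_counting_space_iff)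

lemma point_process_measurable:
  "point_process M \<Phi> \<Longrightarrow> B \<in> sets borel \<Longrightarrow> (\<lambda>\<omega>. emeasure (\<Phi> \<omega>) B) \<in> borel_measurable M"
  by (auto simp: point_process_def measurable_counting_space_iff)

lemma occupied_event_measurable:
  assumes "point_process M \<Phi>" "B \<in> sets borel"
  shows "{\<omega> \<in> space M. emeasure (\<Phi> \<omega>) B \<noteq> 0} \<in> sets M"
  unfolding zero_less_iff_neq_zero[symmetric] using point_process_measurable[OF assms] by measurable

lemma emeasure_cball_finite:
  "\<mu> \<in> radon_counting_measures \<Longrightarrow> emeasure \<mu> (cball y r) < \<infinity>"
  by (simp add: radon_counting_measures_def)

text \<open>Continuity from above along a decreasing sequence, available because bounded sets have
  finite mass.\<close>

lemma tendsto_emeasure_cball_shrink: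
  fixes y :: "'a::euclidean_space"
  assumes \<mu>: "\<mu> \<in> radon_counting_measures"
  shows "(\<lambda>i. emeasure \<mu> (cball y (r + 1 / Suc i))) \<longlonglongrightarrow> emeasure \<mu> (cball y r)"
proof -
  have "(\<Inter>i. cball y (r + 1 / Suc i)) = cball y r"
  proof (intro equalityI subsetI)
    fix x assume x: "x \<in> (\<Inter>i. cball y (r + 1 / Suc i))"
    have "dist y x \<le> r"
    proof (rule field_le_epsilon)
      fix e :: real assume "e > 0"
      then obtain n where n: "1 / Suc n < e" using nat_approx_posE by blast
      from x have "dist y x \<le> r + 1 / Suc n" unfolding INT_iff mem_cball by blast
      then show "dist y x \<le> r + e" using n by linarith
    qed
    then show "x \<in> cball y r" by simp
  next
    fix x assume "x \<in> cball y r"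
    then show "x \<in> (\<Inter>i. cball y (r + 1 / Suc i))" by (auto intro: add_increasing2)
  qed
  moreover have "(\<lambda>i. emeasure \<mu> (cball y (r + 1 / Suc i))) \<longlonglongrightarrow>
      emeasure \<mu> (\<Inter>i. cball y (r + 1 / Suc i))"
  proof (rule Lim_emeasure_decseq)
    show "range (\<lambda>i. cball y (r + 1 / real (Suc i))) \<subseteq> sets \<mu>"
      by (simp add: radon_counting_measures_sets[OF \<mu>] image_subset_iff)
    show "decseq (\<lambda>i. cball y (r + 1 / real (Suc i)))"
      unfolding decseq_def by (intro allI impI subset_cball add_left_mono) (simp add: frac_le)
    show "emeasure \<mu> (cball y (r + 1 / real (Suc i))) \<noteq> \<infinity>" for i
      using emeasure_cball_finite[OF \<mu>, of y "r + 1 / real (Suc i)"] by simp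
  qed
  ultimately show ?thesis by simp
qed

text \<open>The masses of shrinking punctured balls tend to \<open>0\<close>; being integers, they vanish eventually.
  This is why such a measure has no diffuse part.\<close>

lemma emeasure_punctured_ball_zero:
  fixes x :: "'a::euclidean_space"
  assumes \<mu>: "\<mu> \<in> radon_counting_measures"
  obtains d where "d > 0" "emeasure \<mu> (ball x d - {x}) = 0"
proof -
  have s: "sets \<mu> = sets borel" by (rule radon_counting_measures_sets[OF \<mu>])
  define B where "B i = ball x (1 / Suc i) - {x}" for i
  have B: "B i \<in> sets borel" for i by (auto simp: B_def)
  have "(\<Inter>i. B i) = {}"
  proof -
    have "y \<notin> (\<Inter>i. B i)" for y
    proof (cases "y = x")
      case False
      then have "dist x y > 0" by simp
      then obtain n where "1 / Suc n < dist x y" using nat_approx_posE by blast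
      then have "y \<notin> B n" by (simp add: B_def)
      then show ?thesis by blast
    qed (auto simp: B_def)
    then show ?thesis by blast
  qed
  moreover have "(\<lambda>i. emeasure \<mu> (B i)) \<longlonglongrightarrow> emeasure \<mu> (\<Inter>i. B i)"
  proof (rule Lim_emeasure_decseq)
    show "range B \<subseteq> sets \<mu>" using B s by auto
    have "B j \<subseteq> B i" if "i \<le> j" for i j
    proof -
      have "1 / real (Suc j) \<le> 1 / real (Suc i)" using that by (simp add: frac_le)
      then show ?thesis unfolding B_def by (intro Diff_mono subset_ball) auto
    qed
    then show "decseq B" by (auto simp: decseq_def)
    have "bounded (B i)" for i unfolding B_def
      by (rule bounded_subset[OF bounded_ball]) auto
    then show "emeasure \<mu> (B i) \<noteq> \<infinity>" for i
      using \<mu> B[of i] by (auto simp: radon_counting_measures_def less_top)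
  qed
  ultimately have "(\<lambda>i. emeasure \<mu> (B i)) \<longlonglongrightarrow> 0" by simp
  then have "eventually (\<lambda>i. emeasure \<mu> (B i) < 1) sequentially"
    by (rule order_tendstoD) simp
  then obtain i where "emeasure \<mu> (B i) < 1" by (auto simp: eventually_sequentially)
  with radon_counting_measures_nat[OF \<mu> B[of i]] have "emeasure \<mu> (B i) = 0" by auto
  then show thesis by (intro that[of "1 / Suc i"]) (auto simp: B_def)
qed

text \<open>Finitely many balls whose punctured versions are null cover the compact ball, so all its
  mass sits on their finitely many centres \<open>F\<close>. The sum over atoms thereby becomes the
  mass of one fixed Borel set, which is a random variable.\<close>

lemma coverage_eq_emeasure:
  fixes y :: "'a::euclidean_space"
  assumes \<mu>: "\<mu> \<in> radon_counting_measures"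
  shows "coverage \<mu> r y = emeasure \<mu> (cball y r)"
proof -
  have s: "sets \<mu> = sets borel" by (rule radon_counting_measures_sets[OF \<mu>])
  define K where "K = cball y r"
  have "\<exists>d>0. emeasure \<mu> (ball x d - {x}) = 0" for x
    by (rule emeasure_punctured_ball_zero[OF \<mu>, of x]) blast
  then obtain d where d: "\<And>x. d x > 0" "\<And>x. emeasure \<mu> (ball x (d x) - {x}) = 0" by metis
  have "compact K" by (simp add: K_def)
  moreover have "K \<subseteq> (\<Union>x\<in>K. ball x (d x))" using d(1) by auto
  ultimately obtain F where F: "F \<subseteq> K" "finite F" "K \<subseteq> (\<Union>x\<in>F. ball x (d x))"
    by (rule compactE_image[OF _ open_ball]) auto
  have "ball x (d x) - {x} \<in> null_sets \<mu>" for x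
    using d(2) s by (simp add: null_sets_def)
  then have "(\<Union>x\<in>F. ball x (d x) - {x}) \<in> null_sets \<mu>"
    using F(2) by (intro null_sets_UN' countable_finite)
  moreover have "K - F \<subseteq> (\<Union>x\<in>F. ball x (d x) - {x})" using F(3) by auto
  ultimately have null: "emeasure \<mu> A = 0" if "A \<subseteq> K - F" for A
    using that by (meson emeasure_eq_0 null_setsD1 null_setsD2 subset_trans)
  have Fb: "F \<in> sets borel" using F(2) by (intro borel_closed finite_imp_closed)
  have "emeasure \<mu> K = emeasure \<mu> (F \<union> (K - F))" using F(1) by (simp add: Un_absorb1)
  also have "\<dots> = emeasure \<mu> F + emeasure \<mu> (K - F)"
    by (rule plus_emeasure[symmetric]) (auto simp: s K_def Fb)
  also have "\<dots> = (\<Sum>x\<in>F. emeasure \<mu> {x})"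
    using null[of "K - F"] emeasure_eq_sum_singleton[of F \<mu>] F(2) by (simp add: s)
  also have "\<dots> = infsum (\<lambda>x. emeasure \<mu> {x}) F" using F(2) by simp
  also have "\<dots> = (\<Sum>\<^sub>\<infinity>x\<in>{x. emeasure \<mu> {x} \<noteq> 0}. emeasure \<mu> {x} * indicator (cball x r) y)"
  \<comment> \<open>The index sets differ harmlessly: atoms outside \<open>F\<close> lie outside the
    ball, and points of \<open>F\<close> without mass contribute zero.\<close>
  proof (rule infsum_cong_neutral)
    fix x assume "x \<in> {x. emeasure \<mu> {x} \<noteq> 0} - F"
    then have "x \<notin> K" using null[of "{x}"] by auto
    then show "emeasure \<mu> {x} * indicator (cball x r) y = 0" by (auto simp: K_def dist_commute)
  next
    fix x assume "x \<in> F \<inter> {x. emeasure \<mu> {x} \<noteq> 0}"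
    then have "x \<in> K" using F(1) by auto
    then show "emeasure \<mu> {x} = emeasure \<mu> {x} * indicator (cball x r) y"
      by (auto simp: K_def dist_commute)
  qed auto
  finally show ?thesis by (simp add: coverage_def K_def)
qed

lemma covered_set_eq:
  "\<mu> \<in> radon_counting_measures \<Longrightarrow>
    covered_set k \<mu> r = {y. of_nat k \<le> emeasure \<mu> (cball y r)}"
  by (simp add: covered_set_def coverage_eq_emeasure)

lemma covered_set_atom:
  assumes \<mu>: "\<mu> \<in> radon_counting_measures" and y: "y \<in> covered_set 1 \<mu> r"
  obtains x where "dist y x \<le> r" "emeasure \<mu> {x} \<noteq> 0"
proof -
  have "coverage \<mu> r y \<noteq> 0" using y by (auto simp: covered_set_def)
  then obtain x where "emeasure \<mu> {x} * indicator (cball x r) y \<noteq> 0"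
    unfolding coverage_def by (meson infsum_0)
  then show thesis by (intro that[of x]) (auto simp: dist_commute indicator_def split: if_splits)
qed

section \<open>Percolation as a countable combination of events\<close>

section \<open>Measurability of percolation\<close>

text \<open>Loop erasure: when the new endpoint was visited before, the path is cut back to that
  visit. Distinct vertices later give disjoint cells, as both sub-Poisson bounds require.\<close>

lemma rtrancl_distinct_path:
  assumes "(u, v) \<in> {(x, y). x \<in> V \<and> y \<in> V \<and> R x y}\<^sup>*" "u \<in> V"
  shows "\<exists>p. p \<noteq> [] \<and> hd p = u \<and> last p = v \<and> distinct p \<and> set p \<subseteq> V \<and> successively R p"
  using assms(1)
proof (induction rule: rtrancl_induct)
  case base
  show ?case by (rule exI[of _ "[u]"]) (use assms in auto)
next
  case (step v w)
  then obtain p where p: "p \<noteq> []" "hd p = u" "last p = v" "distinct p" "set p \<subseteq> V" "successively R p"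
    by blast
  show ?case
  proof (cases "w \<in> set p")
    case True
    then obtain q r where qr: "p = q @ w # r" by (meson split_list)
    then show ?thesis using p
      by (intro exI[of _ "q @ [w]"]) (cases q; auto simp: successively_append_iff successively_Cons hd_append)
  next
    case False
    then show ?thesis using p step(2)
      by (intro exI[of _ "p @ [w]"]) (auto simp: successively_append_iff)
  qed
qed

text \<open>The points reachable from \<open>x\<close> by steps below \<open>e\<close> form a
  relatively open set, and so do the unreachable ones; connectedness leaves no unreachable
  point.\<close>

lemma connected_chain:
  fixes S :: "'a::metric_space set"
  assumes "connected S" "x \<in> S" "y \<in> S" "0 < e"
  shows "(x, y) \<in> {(a, b). a \<in> S \<and> b \<in> S \<and> dist a b < e}\<^sup>*"
proof -
  let ?R = "{(a, b). a \<in> S \<and> b \<in> S \<and> dist a b < e}"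
  have "sym ?R" by (auto simp: sym_def dist_commute)
  define T where "T = {z \<in> S. (x, z) \<in> ?R\<^sup>*}"
  have step: "b \<in> T" if "a \<in> T" "b \<in> S" "dist a b < e" for a b
    using that unfolding T_def by (auto intro: rtrancl_into_rtrancl)
  have T: "T = S \<inter> (\<Union>a\<in>T. ball a e)"
    using step assms(4) by (auto simp: T_def)
  have ST: "S - T = S \<inter> (\<Union>a\<in>S-T. ball a e)"
    using step assms(4) by (auto simp: dist_commute)
  have "openin (top_of_set S) T" "openin (top_of_set S) (S - T)"
    by (subst T ST, intro openin_open_Int open_UN ballI open_ball)+
  then have "closedin (top_of_set S) T" by (auto simp: closedin_def T_def)
  moreover have "x \<in> T" using assms by (auto simp: T_def)
  ultimately have "T = S"
    using \<open>openin (top_of_set S) T\<close> assms(1) by (auto simp: connected_clopen)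
  then show ?thesis using assms(3) by (auto simp: T_def)
qed

text \<open>A discrete intermediate value principle: the first step that reaches level
  \<open>c\<close> does the crossing.\<close>

lemma rtrancl_crossing:
  fixes h :: "'a \<Rightarrow> real"
  assumes "(u, v) \<in> R\<^sup>*" "h u < c" "c \<le> h v"
  obtains a b where "(a, b) \<in> R" "h a < c" "c \<le> h b"
proof -
  have "\<exists>a b. (a, b) \<in> R \<and> h a < c \<and> c \<le> h b"
    using assms
  proof (induction rule: rtrancl_induct)
    case (step y z)
    then show ?case by (cases "c \<le> h y") (auto simp: not_le)
  qed auto
  then show thesis using that by blast
qed

text \<open>In \<open>critical_radius\<close>, \<open>measure\<close> would be \<open>0\<close> on a non-measurable set, so the percolation event has
  to be exhibited as a countable combination of events: percolation is expressed by finite chains in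
  a countable dense set. If chains from a fixed ball to infinity exist at every scale, a limit point
  of their starting points lies in an unbounded component, since a bounded component could be
  separated from the rest by a compact relatively open set (Sura-Bura), which the chains would have
  to leave through the gap around it.\<close>

lemma percolates_iff_chains:
  fixes A :: "nat \<Rightarrow> 'a::euclidean_space set"
  assumes dense: "\<And>x e. 0 < e \<Longrightarrow> \<exists>d\<in>D. dist x d < e"
    and nbhd: "\<And>m x y. x \<in> B \<Longrightarrow> dist x y < 1 / Suc m \<Longrightarrow> y \<in> A m"
    and lim: "\<And>g y s. strict_mono (g :: nat \<Rightarrow> nat) \<Longrightarrow> (\<And>j. s j \<in> A (g j)) \<Longrightarrow> s \<longlonglongrightarrow> y \<Longrightarrow> y \<in> B"
  shows "percolates B \<longleftrightarrow> (\<exists>n. \<forall>m. \<exists>u\<in>D. \<exists>v\<in>D. norm u \<le> real n \<and> real m \<le> norm v \<and> u \<in> A m \<and>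
    (u, v) \<in> {(a, b). a \<in> D \<inter> A m \<and> b \<in> D \<inter> A m \<and> dist a b < 3 / Suc m}\<^sup>*)"
    (is "_ \<longleftrightarrow> (\<exists>n. \<forall>m. \<exists>u\<in>D. \<exists>v\<in>D. ?C n m u v)")
proof
  assume "percolates B"
  then obtain S where S: "S \<subseteq> B" "connected S" "\<not> bounded S" by (auto simp: percolates_def)
  then obtain x where x: "x \<in> S" by fastforce
  obtain n :: nat where n: "norm x + 1 \<le> real n" using real_arch_simple by blast
  have "\<exists>u\<in>D. \<exists>v\<in>D. ?C n m u v" for m
  proof -
    obtain y where y: "y \<in> S" "real m + 1 < norm y"
      using S(3) unfolding bounded_iff by (meson not_le)
    \<comment> \<open>Chain steps in \<open>S\<close> are shorter than \<open>e\<close>, and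
      rounding each endpoint into \<open>D\<close> costs less than \<open>e\<close>; hence the
      tolerance \<open>3 / Suc m\<close>.\<close>
    define e :: real where "e = 1 / Suc m"
    have e: "0 < e" "e \<le> 1" "3 / Suc m = e + e + e" by (auto simp: e_def field_simps)
    obtain q where q: "\<And>z. q z \<in> D" "\<And>z. dist z (q z) < e" using dense[OF e(1)] by metis
    have qA: "q z \<in> A m" if "z \<in> S" for z
      using nbhd[of z "q z" m] q(2)[of z] S(1) that by (auto simp: e_def)
    have "(q x, q y) \<in> {(a, b). a \<in> D \<inter> A m \<and> b \<in> D \<inter> A m \<and> dist a b < 3 / Suc m}\<^sup>*"
      using connected_chain[OF S(2) x y(1) e(1)]
    proof (induction rule: rtrancl_induct)
      case (step a b)
      then have "dist (q a) (q b) < 3 / Suc m"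
        unfolding e(3) using q(2)[of a] q(2)[of b]
          dist_triangle[of "q a" "q b" a] dist_triangle[of a "q b" b] by (auto simp: dist_commute)
      then show ?case using step q qA by (intro rtrancl_into_rtrancl[OF step(3)]) auto
    qed simp
    moreover have "norm (q x) \<le> n"
      using n q(2)[of x] e norm_triangle_ineq3[of x "q x"] by (simp add: dist_norm)
    moreover have "m \<le> norm (q y)"
      using y q(2)[of y] e norm_triangle_ineq3[of y "q y"] by (simp add: dist_norm)
    ultimately show ?thesis using q qA[OF x] by blast
  qed
  then show "\<exists>n. \<forall>m. \<exists>u\<in>D. \<exists>v\<in>D. ?C n m u v" by blast
next
  assume "\<exists>n. \<forall>m. \<exists>u\<in>D. \<exists>v\<in>D. ?C n m u v"
  then obtain n where "\<forall>m. \<exists>u v. ?C n m u v" by blast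
  from choice[OF this] obtain u where "\<forall>m. \<exists>v. ?C n m (u m) v" by blast
  from choice[OF this] obtain v where uv: "\<And>m. ?C n m (u m) (v m)" by blast
  have BA: "x \<in> A m" if "x \<in> B" for x m using nbhd[OF that, of x m] by simp
  have closed: "closed B"
    unfolding closed_sequential_limits
  proof (intro allI impI)
    fix s l assume "(\<forall>n. s n \<in> B) \<and> s \<longlonglongrightarrow> l"
    then show "l \<in> B" using lim[OF strict_mono_id, of s l] BA by simp
  qed
  obtain x g where g: "strict_mono (g :: nat \<Rightarrow> nat)" "(u \<circ> g) \<longlonglongrightarrow> x"
    using uv compact_cball[of "0::'a" n] unfolding compact_def mem_cball_0 by blast
  have xB: "x \<in> B" using lim[OF g(1) _ g(2)] uv by auto
  show "percolates B"
  proof (rule ccontr)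
    assume np: "\<not> percolates B"
    define C where "C = connected_component_set B x"
    have C: "C \<subseteq> B" "connected C" "x \<in> C" "C \<in> components B"
      using xB by (auto simp: C_def connected_component_subset componentsI)
    then have "bounded C" using np by (auto simp: percolates_def)
    then have "compact C"
      using closed by (auto simp: C_def compact_eq_bounded_closed closed_connected_component)
    then obtain K where K: "openin (top_of_set B) K" "compact K" "C \<subseteq> K"
      using Sura_Bura_clopen_subset[OF closed_imp_locally_compact[OF closed] C(4), of UNIV] by auto
    \<comment> \<open>\<open>K\<close> is open relative to the closed set \<open>B\<close>, so the
      rest of \<open>B\<close> is closed and keeps a positive distance \<open>d\<close> from the
      compact \<open>K\<close>.\<close>
    have "closed (B - K)"
      using K(1) closed by (metis closedin_closed_trans closedin_diff closedin_topspace
          openin_closedin_eq openin_subset topspace_euclidean_subtopology closedin_def double_diff subset_refl)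
    then obtain d where d: "d > 0" "\<And>k y. k \<in> K \<Longrightarrow> y \<in> B - K \<Longrightarrow> d \<le> dist k y"
      using separate_compact_closed[OF K(2), of "B - K"] by blast
    \<comment> \<open>The band where \<open>h\<close> is between \<open>d / 3\<close> and
      \<open>2 * d / 3\<close> misses \<open>B\<close>, since \<open>h\<close> vanishes on
      \<open>K\<close> and is at least \<open>d\<close> on \<open>B - K\<close>. The chains will be
      caught inside this band, and a limit of such points lies in \<open>B\<close>.\<close>
    define h where "h y = infdist y K" for y
    have Kne: "K \<noteq> {}" using C(3) K(3) by blast
    have cont: "isCont h y" for y unfolding h_def by (intro continuous_infdist continuous_ident)
    have lip: "h b \<le> h a + dist a b" for a b
      unfolding h_def using infdist_triangle[of b K a] by (simp add: dist_commute)
    have attain: "\<exists>k\<in>K. h y = dist y k" for y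
      unfolding h_def using infdist_attains_inf[OF compact_imp_closed[OF K(2)] Kne] by metis
    obtain R where R: "\<And>k. k \<in> K \<Longrightarrow> norm k \<le> R"
      using compact_imp_bounded[OF K(2)] by (auto simp: bounded_iff)
    have nh: "norm y \<le> R + h y" for y
    proof -
      obtain k where "k \<in> K" "h y = dist y k" using attain by blast
      then show ?thesis using R[of k] norm_triangle_ineq2[of y k] by (simp add: dist_norm)
    qed
    have "(\<lambda>j. h ((u \<circ> g) j)) \<longlonglongrightarrow> h x" by (rule isCont_tendsto_compose[OF cont g(2)])
    moreover have "h x = 0" using C(3) K(3) by (auto simp: h_def)
    ultimately have "eventually (\<lambda>j. h (u (g j)) < d / 3) sequentially"
      using order_tendstoD(2)[of "\<lambda>j. h ((u \<circ> g) j)" 0 _ "d/3"] d(1) by simp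
    moreover have "eventually (\<lambda>j. R + d < real j) sequentially"
      using filterlim_real_sequentially by (simp add: filterlim_at_top_dense)
    \<comment> \<open>With \<open>d / 9\<close> the chain steps, below \<open>3 / Suc j\<close>, are
      shorter than \<open>d / 3\<close>, the width of the band.\<close>
    moreover have "eventually (\<lambda>j. inverse (real (Suc j)) < d / 9) sequentially"
      using order_tendstoD(2)[OF LIMSEQ_inverse_real_of_nat, of "d / 9"] d(1) by simp
    ultimately have "eventually (\<lambda>j. \<exists>w \<in> A (g j). d / 3 \<le> h w \<and> h w \<le> 2 * d / 3) sequentially"
    proof eventually_elim
      case (elim j)
      have gj: "j \<le> g j" by (rule strict_mono_imp_increasing[OF g(1)])
      have "R + d < norm (v (g j))" using uv[of "g j"] gj elim(2) by linarith
      then have "d / 3 \<le> h (v (g j))" using nh[of "v (g j)"] d(1) by linarith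
      let ?S = "{(a, b). a \<in> D \<inter> A (g j) \<and> b \<in> D \<inter> A (g j) \<and> dist a b < 3 / Suc (g j)}"
      have "(u (g j), v (g j)) \<in> ?S\<^sup>*" using uv[of "g j"] by blast
      \<comment> \<open>The chain starts near \<open>x\<close>, below level \<open>d / 3\<close>,
        and ends far from the bounded set \<open>K\<close>; the crossing step is too short to jump
        over the band.\<close>
      then obtain a b where ab: "(a, b) \<in> ?S" "h a < d / 3" "d / 3 \<le> h b"
        by (rule rtrancl_crossing[of _ _ _ h "d / 3"]) (use elim(1) \<open>d / 3 \<le> h (v (g j))\<close> in auto)
      have "3 / real (Suc (g j)) \<le> 3 / real (Suc j)" using gj by (intro divide_left_mono) auto
      also have "\<dots> < d / 3" using elim(3) by (simp add: field_simps)
      finally have "h b \<le> 2 * d / 3" using ab lip[of b a] by auto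
      then show ?case using ab by blast
    qed
    \<comment> \<open>Only indices from \<open>J\<close> on are controlled, so compactness is
      applied to the shifted sequence.\<close>
    then obtain J where "\<forall>j. \<exists>w. J \<le> j \<longrightarrow> w \<in> A (g j) \<and> d / 3 \<le> h w \<and> h w \<le> 2 * d / 3"
      unfolding eventually_sequentially by blast
    from choice[OF this] obtain w
      where w: "\<And>j. J \<le> j \<Longrightarrow> w j \<in> A (g j) \<and> d / 3 \<le> h (w j) \<and> h (w j) \<le> 2 * d / 3" by blast
    have "w (j + J) \<in> cball 0 (R + d)" for j
      using nh[of "w (j + J)"] w[of "j + J"] d(1) by auto
    then obtain y f where f: "strict_mono (f :: nat \<Rightarrow> nat)" "((\<lambda>j. w (j + J)) \<circ> f) \<longlonglongrightarrow> y"
      using compact_cball[of "0::'a" "R + d"] unfolding compact_def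
      by (auto dest!: spec[of _ "\<lambda>j. w (j + J)"])
    have "strict_mono (\<lambda>j. g (f j + J))"
      using g(1) f(1) by (auto simp: strict_mono_def)
    then have "y \<in> B" using lim[OF _ _ f(2), of "\<lambda>j. g (f j + J)"] w by simp
    have hlim: "(\<lambda>j. h (((\<lambda>j. w (j + J)) \<circ> f) j)) \<longlonglongrightarrow> h y"
      by (rule isCont_tendsto_compose[OF cont f(2)])
    have "d / 3 \<le> h y" by (rule LIMSEQ_le_const[OF hlim]) (use w in auto)
    moreover have "h y \<le> 2 * d / 3" by (rule LIMSEQ_le_const2[OF hlim]) (use w in auto)
    moreover obtain k where "k \<in> K" "h y = dist y k" using attain by blast
    moreover have "y \<notin> K" using \<open>d / 3 \<le> h y\<close> d(1) by (auto simp: h_def)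
    ultimately show False using d \<open>y \<in> B\<close> by (force simp: dist_commute)
  qed
qed

text \<open>Centres and radii vary together: for large \<open>j\<close> the ball around
  \<open>s j\<close> lies in any slightly enlarged ball around \<open>y\<close>, and shrinking the
  enlargement uses continuity from above. This supplies the limit hypothesis of
  \<open>percolates_iff_chains\<close>.\<close>

lemma covered_set_limit:
  assumes \<mu>: "\<mu> \<in> radon_counting_measures"
    and g: "strict_mono (g :: nat \<Rightarrow> nat)" and s: "s \<longlonglongrightarrow> y"
    and k: "\<And>j. of_nat k \<le> emeasure \<mu> (cball (s j) (r + 1 / Suc (g j)))"
  shows "y \<in> covered_set k \<mu> r"
proof -
  have "of_nat k \<le> emeasure \<mu> (cball y (r + 1 / Suc i))" for i
  proof -
    define e :: real where "e = 1 / Suc i"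
    have "e > 0" by (simp add: e_def)
    then have "eventually (\<lambda>j. dist (s j) y < e / 2) sequentially"
      using tendstoD[OF s, of "e / 2"] by simp
    moreover have "eventually (\<lambda>j. inverse (real (Suc j)) < e / 2) sequentially"
      using order_tendstoD(2)[OF LIMSEQ_inverse_real_of_nat, of "e / 2"] \<open>e > 0\<close> by simp
    ultimately have "eventually (\<lambda>j. cball (s j) (r + 1 / Suc (g j)) \<subseteq> cball y (r + e)) sequentially"
    proof eventually_elim
      case (elim j)
      have "1 / real (Suc (g j)) \<le> 1 / real (Suc j)"
        using strict_mono_imp_increasing[OF g, of j] by (intro divide_left_mono) auto
      then have "1 / real (Suc (g j)) < e / 2" using elim(2) by (simp add: inverse_eq_divide)
      with elim(1) have "r + 1 / Suc (g j) + dist y (s j) \<le> r + e"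
        unfolding dist_commute[of y] by linarith
      then show ?case by (simp add: cball_subset_cball_iff dist_commute)
    qed
    then obtain j where "cball (s j) (r + 1 / Suc (g j)) \<subseteq> cball y (r + e)"
      by (auto simp: eventually_sequentially)
    then have "emeasure \<mu> (cball (s j) (r + 1 / Suc (g j))) \<le> emeasure \<mu> (cball y (r + e))"
      by (intro emeasure_mono) (auto simp: radon_counting_measures_sets[OF \<mu>])
    then show ?thesis using k[of j] by (simp add: e_def)
  qed
  then have "of_nat k \<le> emeasure \<mu> (cball y r)"
    by (intro LIMSEQ_le_const[OF tendsto_emeasure_cball_shrink[OF \<mu>]]) auto
  then show ?thesis by (simp add: covered_set_eq[OF \<mu>])
qed

lemma countable_dense_points:
  obtains D :: "'a::euclidean_space set"
  where "countable D" "\<And>x e. 0 < e \<Longrightarrow> \<exists>d\<in>D. dist x d < e"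
proof -
  obtain D :: "'a set" where D: "countable D" "\<And>X. open X \<Longrightarrow> X \<noteq> {} \<Longrightarrow> \<exists>d\<in>D. d \<in> X"
    using countable_dense_setE by blast
  show thesis
  proof (rule that[OF D(1)])
    fix x :: 'a and e :: real assume "0 < e"
    then show "\<exists>d\<in>D. dist x d < e" using D(2)[of "ball x e"] by auto
  qed
qed

text \<open>Enlarging the radius by \<open>1 / Suc m\<close> absorbs the rounding to a countable
  dense \<open>D\<close>. Reachability in \<open>D\<close> is a countable union over powers of a
  random relation, so only countably many ball masses enter.\<close>

lemma percolation_event_measurable:
  fixes \<Phi> :: "'w \<Rightarrow> 'a::euclidean_space measure"
  assumes "point_process M \<Phi>"
  shows "{\<omega> \<in> space M. percolates (covered_set k (\<Phi> \<omega>) r)} \<in> sets M"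
proof -
  obtain D :: "'a set" where D: "countable D" "\<And>x e. 0 < e \<Longrightarrow> \<exists>d\<in>D. dist x d < e"
    using countable_dense_points by blast
  note rad = point_process_radon[OF assms]
  note meas = point_process_measurable[OF assms]
  define A where "A \<omega> m = {y. of_nat k \<le> emeasure (\<Phi> \<omega>) (cball y (r + 1 / real (Suc m)))}" for \<omega> m
  define S where "S \<omega> m = {(a, b). a \<in> D \<inter> A \<omega> m \<and> b \<in> D \<inter> A \<omega> m \<and> dist a b < 3 / real (Suc m)}" for \<omega> m
  have A_meas: "{\<omega> \<in> space M. y \<in> A \<omega> m} \<in> sets M" for y m
    unfolding A_def mem_Collect_eq using meas[of "cball y (r + 1 / real (Suc m))"] by measurable
  have S_meas: "{\<omega> \<in> space M. (a, b) \<in> S \<omega> m} \<in> sets M" for a b m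
    unfolding S_def using A_meas
    by (auto intro!: sets.sets_Collect_conj sets.sets_Collect_const)
  have pow_meas: "{\<omega> \<in> space M. (a, b) \<in> S \<omega> m ^^ i} \<in> sets M" for a b m i
  proof (induction i arbitrary: b)
    case 0
    then show ?case by (auto intro!: sets.sets_Collect_const)
  next
    case (Suc i)
    \<comment> \<open>The intermediate point may be restricted to \<open>D\<close>, because
      \<open>S\<close> relates only points of \<open>D\<close>.\<close>
    have "{\<omega> \<in> space M. (a, b) \<in> S \<omega> m ^^ Suc i} =
        {\<omega> \<in> space M. \<exists>c\<in>D. (a, c) \<in> S \<omega> m ^^ i \<and> (c, b) \<in> S \<omega> m}"
      by (auto simp: S_def)
    also have "\<dots> \<in> sets M"
      by (intro sets.sets_Collect_countable_Ex' sets.sets_Collect_conj Suc S_meas D(1))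
    finally show ?case .
  qed
  have "percolates (covered_set k (\<Phi> \<omega>) r) \<longleftrightarrow> (\<exists>n. \<forall>m. \<exists>u\<in>D. \<exists>v\<in>D. (norm u \<le> real n \<and> real m \<le> norm v) \<and> u \<in> A \<omega> m \<and>
    (\<exists>i. (u, v) \<in> S \<omega> m ^^ i))" if "\<omega> \<in> space M" for \<omega>
  proof -
    have "percolates (covered_set k (\<Phi> \<omega>) r) \<longleftrightarrow> (\<exists>n. \<forall>m. \<exists>u\<in>D. \<exists>v\<in>D. norm u \<le> real n \<and> real m \<le> norm v \<and> u \<in> A \<omega> m \<and>
      (u, v) \<in> (S \<omega> m)\<^sup>*)"
      unfolding S_def
    proof (rule percolates_iff_chains[OF D(2)])
      fix m x y assume xy: "x \<in> covered_set k (\<Phi> \<omega>) r" "dist x y < 1 / Suc m"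
      have "cball x r \<subseteq> cball y (r + 1 / real (Suc m))"
        using xy(2) by (simp add: cball_subset_cball_iff)
      then have "emeasure (\<Phi> \<omega>) (cball x r) \<le> emeasure (\<Phi> \<omega>) (cball y (r + 1 / real (Suc m)))"
        by (intro emeasure_mono) (auto simp: radon_counting_measures_sets[OF rad[OF that]])
      then show "y \<in> A \<omega> m" using xy(1) by (auto simp: A_def covered_set_eq[OF rad[OF that]])
    next
      fix g y s assume "strict_mono (g :: nat \<Rightarrow> nat)" "\<And>j. s j \<in> A \<omega> (g j)" "s \<longlonglongrightarrow> y"
      then show "y \<in> covered_set k (\<Phi> \<omega>) r"
        using covered_set_limit[OF rad[OF that]] by (simp add: A_def)
    qed
    then show ?thesis by (simp add: rtrancl_power conj_assoc)
  qed
  then have "{\<omega> \<in> space M. percolates (covered_set k (\<Phi> \<omega>) r)} =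
    {\<omega> \<in> space M. \<exists>n. \<forall>m. \<exists>u\<in>D. \<exists>v\<in>D. (norm u \<le> real n \<and> real m \<le> norm v) \<and> u \<in> A \<omega> m \<and>
    (\<exists>i. (u, v) \<in> S \<omega> m ^^ i)}" by blast
  also have "\<dots> \<in> sets M"
    by (intro sets.sets_Collect_countable_Ex sets.sets_Collect_countable_All
        sets.sets_Collect_countable_Ex'[OF _ D(1)] sets.sets_Collect_conj sets.sets_Collect_const A_meas pow_meas)
  finally show ?thesis .
qed

section \<open>Integer points, their adjacency and the number of paths\<close>

section \<open>Lattice paths\<close>

definition lattice :: "'a::euclidean_space set" where
  "lattice = {z. \<forall>b\<in>Basis. z \<bullet> b \<in> \<int>}"

definition lattice_floor :: "'a::euclidean_space \<Rightarrow> 'a" where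
  "lattice_floor x = (\<Sum>b\<in>Basis. of_int \<lfloor>x \<bullet> b\<rfloor> *\<^sub>R b)"

text \<open>Sup-norm adjacency: diagonal neighbours count, and so does the point itself.\<close>

definition lattice_adj :: "'a::euclidean_space \<Rightarrow> 'a \<Rightarrow> bool" where
  "lattice_adj z w \<longleftrightarrow> (\<forall>b\<in>Basis. \<bar>z \<bullet> b - w \<bullet> b\<bar> \<le> 1)"

text \<open>The \<open>3 ^ DIM('a)\<close> possible increments, zero included. Their number is the
  branching constant in both path counts.\<close>

definition lattice_steps :: "'a::euclidean_space set" where
  "lattice_steps = {z \<in> lattice. lattice_adj z 0}"

text \<open>The number counts vertices, not steps. Repetitions are allowed, and self-avoidance is
  imposed separately where it matters.\<close>

primrec lattice_paths :: "nat \<Rightarrow> 'a::euclidean_space \<Rightarrow> 'a list set" where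
  "lattice_paths 0 u = {[]}"
| "lattice_paths (Suc n) u = (\<Union>d\<in>lattice_steps. (#) u ` lattice_paths n (u + d))"

lemma lattice_floor_inner [simp]: "b \<in> Basis \<Longrightarrow> lattice_floor x \<bullet> b = of_int \<lfloor>x \<bullet> b\<rfloor>"
  by (simp add: lattice_floor_def inner_sum_left_Basis)

lemma lattice_floor_in_lattice [simp]: "lattice_floor x \<in> lattice"
  by (simp add: lattice_def)

lemma lattice_floor_id:
  assumes "z \<in> lattice"
  shows "lattice_floor z = z"
proof (rule euclidean_eqI)
  fix b :: 'a assume b: "b \<in> Basis"
  then have "z \<bullet> b \<in> \<int>" using assms by (simp add: lattice_def)
  then show "lattice_floor z \<bullet> b = z \<bullet> b" using b by (auto elim: Ints_cases)
qed

lemma lattice_diff: "z \<in> lattice \<Longrightarrow> w \<in> lattice \<Longrightarrow> z - w \<in> lattice"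
  by (simp add: lattice_def inner_diff_left)

lemma finite_lattice_bounded: "finite {z \<in> lattice. norm z \<le> R}"
proof (rule finite_subset)
  let ?I = "{- \<lceil>R\<rceil>..\<lceil>R\<rceil>}"
  show "{z \<in> lattice. norm z \<le> R} \<subseteq>
      (\<lambda>f. \<Sum>b\<in>Basis. of_int (f b) *\<^sub>R b) ` (\<Pi>\<^sub>E b\<in>(Basis::'a set). ?I)"
  proof
    fix z :: 'a assume "z \<in> {z \<in> lattice. norm z \<le> R}"
    then have z: "z \<in> lattice" "norm z \<le> R" by auto
    define f where "f = restrict (\<lambda>b. \<lfloor>z \<bullet> b\<rfloor>) Basis"
    have "\<lfloor>z \<bullet> b\<rfloor> \<in> ?I" if "b \<in> Basis" for b
    proof -
      have "\<bar>z \<bullet> b\<bar> \<le> R" using Basis_le_norm[OF that, of z] z by linarith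
      then show ?thesis by (auto simp: abs_le_iff) linarith+
    qed
    then have "f \<in> (\<Pi>\<^sub>E b\<in>Basis. ?I)" by (auto simp: f_def)
    moreover have "(\<Sum>b\<in>Basis. of_int (f b) *\<^sub>R b) = lattice_floor z"
      by (simp add: f_def lattice_floor_def)
    then have "z = (\<Sum>b\<in>Basis. of_int (f b) *\<^sub>R b)"
      using lattice_floor_id[OF z(1)] by simp
    ultimately show "z \<in> (\<lambda>f. \<Sum>b\<in>Basis. of_int (f b) *\<^sub>R b) ` (\<Pi>\<^sub>E b\<in>Basis. ?I)" by blast
  qed
  show "finite ((\<lambda>f. \<Sum>b\<in>Basis. of_int (f b) *\<^sub>R b) ` (\<Pi>\<^sub>E b\<in>(Basis::'a set). ?I))"
    by (intro finite_imageI finite_PiE) auto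
qed

lemma finite_lattice_steps: "finite (lattice_steps :: 'a::euclidean_space set)"
proof (rule finite_subset[OF _ finite_lattice_bounded])
  show "lattice_steps \<subseteq> {z \<in> lattice. norm (z::'a) \<le> DIM('a)}"
  proof (clarsimp simp: lattice_steps_def)
    fix z :: 'a assume "lattice_adj z 0"
    then have "(\<Sum>b\<in>Basis. \<bar>z \<bullet> b\<bar>) \<le> of_nat DIM('a) * 1"
      by (intro sum_bounded_above) (auto simp: lattice_adj_def)
    then show "norm z \<le> DIM('a)" using norm_le_l1[of z] by linarith
  qed
qed

lemma card_lattice_steps_pos: "0 < card (lattice_steps :: 'a::euclidean_space set)"
proof -
  have "(0::'a) \<in> lattice_steps" by (simp add: lattice_steps_def lattice_def lattice_adj_def)
  then show ?thesis using finite_lattice_steps card_gt_0_iff by blast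
qed

lemma finite_lattice_paths: "finite (lattice_paths n u)"
  by (induction n arbitrary: u) (auto simp: finite_lattice_steps)

lemma length_lattice_paths: "p \<in> lattice_paths n u \<Longrightarrow> length p = n"
  by (induction n arbitrary: u p) auto

lemma card_lattice_paths:
  "card (lattice_paths n (u::'a::euclidean_space)) \<le> card (lattice_steps :: 'a set) ^ n"
proof (induction n arbitrary: u)
  case (Suc n)
  have "card (lattice_paths (Suc n) u) \<le>
      (\<Sum>d\<in>(lattice_steps::'a set). card ((#) u ` lattice_paths n (u + d)))"
    by (simp add: card_UN_le finite_lattice_steps)
  also have "\<dots> \<le> (\<Sum>d\<in>(lattice_steps::'a set). card (lattice_steps :: 'a set) ^ n)"
    by (intro sum_mono order.trans[OF card_image_le Suc] finite_lattice_paths)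
  finally show ?case by simp
qed simp

lemma lattice_pathsI:
  assumes "successively lattice_adj (u # p)" "set (u # p) \<subseteq> lattice"
  shows "u # p \<in> lattice_paths (Suc (length p)) u"
  using assms
proof (induction p arbitrary: u)
  case Nil
  \<comment> \<open>Even the last vertex is formed under a union over increments, so a one-vertex
    path exists because there is at least one increment.\<close>
  then show ?case using card_lattice_steps_pos[where 'a='a] card_gt_0_iff by auto
next
  case (Cons v p)
  have "v - u \<in> lattice_steps"
    using Cons.prems by (auto simp: lattice_steps_def lattice_diff lattice_adj_def inner_diff_left abs_minus_commute)
  moreover have "v # p \<in> lattice_paths (Suc (length p)) (u + (v - u))"
    using Cons by simp
  ultimately show ?case
    unfolding lattice_paths.simps(2)[of "length (v # p)"] by (intro UN_I[of "v - u"] imageI) simp_all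
qed

text \<open>Each step moves a coordinate by at most one; the additional 1 accounts for the first
  vertex.\<close>

lemma lattice_path_length:
  assumes "successively lattice_adj p" "p \<noteq> []" "b \<in> Basis"
  shows "\<bar>hd p \<bullet> b - last p \<bullet> b\<bar> + 1 \<le> length p"
  using assms(1,2)
proof (induction p rule: induct_list012)
  case (3 x y zs)
  then have "\<bar>y \<bullet> b - last (y # zs) \<bullet> b\<bar> + 1 \<le> length (y # zs)" "\<bar>x \<bullet> b - y \<bullet> b\<bar> \<le> 1"
    using assms(3) by (auto simp: lattice_adj_def)
  then show ?case by simp
qed auto

text \<open>In the applications \<open>f x\<close> is a cube at or near \<open>x\<close>, represented by its lowest corner.\<close>

lemma connected_lattice_path:
  fixes f :: "'b::metric_space \<Rightarrow> 'a::euclidean_space"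
  assumes S: "connected S" "x \<in> S" "y \<in> S" and "0 < e"
    and adj: "\<And>a b. a \<in> S \<Longrightarrow> b \<in> S \<Longrightarrow> dist a b < e \<Longrightarrow> lattice_adj (f a) (f b)"
    and V: "f ` S \<subseteq> V" "V \<subseteq> lattice"
    and b: "b \<in> Basis" "real n \<le> \<bar>f x \<bullet> b - f y \<bullet> b\<bar>"
  shows "\<exists>p\<in>lattice_paths (Suc n) (f x). distinct p \<and> set p \<subseteq> V"
proof -
  \<comment> \<open>A chain of short steps in \<open>S\<close> is pushed forward by \<open>f\<close>
    to a walk of adjacent lattice points in \<open>V\<close>, from which loops are then
    erased.\<close>
  have "(f x, f y) \<in> {(z, w). z \<in> V \<and> w \<in> V \<and> lattice_adj z w}\<^sup>*"
    using connected_chain[OF S \<open>0 < e\<close>]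
  proof (induction rule: rtrancl_induct)
    case (step y z)
    then have "(f y, f z) \<in> {(z, w). z \<in> V \<and> w \<in> V \<and> lattice_adj z w}"
      using adj V by auto
    then show ?case using step by (meson rtrancl_into_rtrancl)
  qed simp
  then obtain p where p: "p \<noteq> []" "hd p = f x" "last p = f y" "distinct p" "set p \<subseteq> V"
      "successively lattice_adj p"
    using rtrancl_distinct_path[of "f x" "f y" V lattice_adj] S V by blast
  have len: "Suc n \<le> length p" using lattice_path_length[OF p(6,1) b(1)] p(2,3) b(2) by simp
  obtain q where q: "p = f x # q" using p(1,2) by (cases p) auto
  \<comment> \<open>The displacement only bounds the length from below, so the path is cut to
    exactly \<open>Suc n\<close> vertices; distinctness and containment in \<open>V\<close>
    survive.\<close>
  have eq: "take (Suc n) p = f x # take n q" by (simp add: q)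
  have "successively lattice_adj (f x # take n q)"
    unfolding eq[symmetric] using p(6)
    by (metis append_take_drop_id successively_append_iff)
  moreover have "set (f x # take n q) \<subseteq> V"
    unfolding eq[symmetric] using p(5) by (rule order.trans[OF set_take_subset])
  moreover have "length (take n q) = n" using len by (simp add: q)
  ultimately have "take (Suc n) p \<in> lattice_paths (Suc n) (f x)"
    using lattice_pathsI[of "f x" "take n q"] V(2) unfolding eq by (metis subset_trans)
  moreover have "distinct (take (Suc n) p)" using p(4) by simp
  moreover have "set (take (Suc n) p) \<subseteq> V"
    using p(5) by (rule order.trans[OF set_take_subset])
  ultimately show ?thesis by blast
qed

section \<open>The Peierls argument, carried out on frontiers in continuous space\<close>

section \<open>Boundaries of bounded clusters\<close>

text \<open>Closed cubes, so that cells sharing a face, an edge or a corner have a connected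
  union.\<close>

definition unit_cell :: "'a::euclidean_space \<Rightarrow> 'a set" where
  "unit_cell z = cbox z (z + One)"

lemma mem_unit_cell: "x \<in> unit_cell z \<longleftrightarrow> (\<forall>b\<in>Basis. z \<bullet> b \<le> x \<bullet> b \<and> x \<bullet> b \<le> z \<bullet> b + 1)"
  by (simp add: unit_cell_def mem_box inner_add_left)

lemma unit_cell_lattice_floor: "x \<in> unit_cell (lattice_floor x)"
  by (simp add: mem_unit_cell)

text \<open>Comparison with the l1 norm gives this crude diameter; it reappears as the factor
  \<open>DIM('a)\<close> in the supercritical radius.\<close>

lemma norm_diff_unit_cell:
  fixes z :: "'a::euclidean_space"
  assumes "x \<in> unit_cell z" "y \<in> unit_cell z"
  shows "norm (x - y) \<le> DIM('a)"
proof -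
  have "(\<Sum>b\<in>Basis. \<bar>(x - y) \<bullet> b\<bar>) \<le> of_nat DIM('a) * 1"
  proof (rule sum_bounded_above)
    fix b :: 'a assume b: "b \<in> Basis"
    then have "z \<bullet> b \<le> x \<bullet> b" "x \<bullet> b \<le> z \<bullet> b + 1" "z \<bullet> b \<le> y \<bullet> b" "y \<bullet> b \<le> z \<bullet> b + 1"
      using assms by (auto simp: mem_unit_cell)
    then show "\<bar>(x - y) \<bullet> b\<bar> \<le> 1" by (simp add: inner_diff_left)
  qed
  then show ?thesis using norm_le_l1[of "x - y"] by linarith
qed

lemma lattice_adjI:
  assumes "z \<in> lattice" "w \<in> lattice" "\<And>b. b \<in> Basis \<Longrightarrow> \<bar>z \<bullet> b - w \<bullet> b\<bar> < 2"
  shows "lattice_adj z w"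
  unfolding lattice_adj_def
proof
  fix b :: 'a assume b: "b \<in> Basis"
  then have "z \<bullet> b - w \<bullet> b \<in> \<int>" using assms(1,2) by (auto simp: lattice_def)
  then obtain i where "z \<bullet> b - w \<bullet> b = of_int i" by (auto elim: Ints_cases)
  moreover from this have "\<bar>i\<bar> < 2" using assms(3)[OF b] by linarith
  ultimately show "\<bar>z \<bullet> b - w \<bullet> b\<bar> \<le> 1" by simp
qed

text \<open>Local finiteness: only finitely many cells come within distance 1 of \<open>x\<close>,
  and those missing \<open>x\<close> have a closed union, hence stay at a positive distance.\<close>

lemma unit_cell_nearby:
  fixes x :: "'a::euclidean_space"
  obtains d where "0 < d" "\<And>y z. z \<in> lattice \<Longrightarrow> dist x y < d \<Longrightarrow> y \<in> unit_cell z \<Longrightarrow> x \<in> unit_cell z"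
proof -
  define F where "F = {z \<in> lattice. norm z \<le> norm x + 1 + DIM('a) \<and> x \<notin> unit_cell z}"
  have "finite F"
    by (rule finite_subset[OF _ finite_lattice_bounded[of "norm x + 1 + DIM('a)"]]) (auto simp: F_def)
  then have "closed (\<Union>z\<in>F. unit_cell z)" by (intro closed_UN) (auto simp: unit_cell_def)
  moreover have "x \<notin> (\<Union>z\<in>F. unit_cell z)" by (auto simp: F_def)
  ultimately obtain e where e: "0 < e" "ball x e \<inter> (\<Union>z\<in>F. unit_cell z) = {}"
    by (metis Compl_iff open_Compl open_contains_ball disjoint_eq_subset_Compl)
  show thesis
  proof (rule that[of "min e 1"])
    show "0 < min e 1" using e by simp
  next
    fix y z :: 'a assume z: "z \<in> lattice" and y: "dist x y < min e 1" "y \<in> unit_cell z"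
    have "z \<in> unit_cell z" by (simp add: mem_unit_cell)
    then have "norm z \<le> norm y + DIM('a)"
      using norm_diff_unit_cell[of z z y] y(2) norm_triangle_ineq2[of z y] by linarith
    moreover have "norm y \<le> norm x + 1"
      using y(1) norm_triangle_ineq2[of y x] by (simp add: dist_norm norm_minus_commute)
    moreover have "z \<notin> F" using e(2) y by auto
    ultimately show "x \<in> unit_cell z" using z by (auto simp: F_def)
  qed
qed

lemma closed_Union_unit_cells:
  assumes "V \<subseteq> lattice"
  shows "closed (\<Union>z\<in>V. unit_cell z)"
proof -
  have "\<exists>d>0. ball x d \<subseteq> - (\<Union>z\<in>V. unit_cell z)" if "x \<in> - (\<Union>z\<in>V. unit_cell z)" for x
  proof -
    obtain d where d: "0 < d" "\<And>y z. z \<in> lattice \<Longrightarrow> dist x y < d \<Longrightarrow> y \<in> unit_cell z \<Longrightarrow> x \<in> unit_cell z"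
      using unit_cell_nearby[of x] by blast
    have "ball x d \<subseteq> - (\<Union>z\<in>V. unit_cell z)" using d(2) that assms by fastforce
    then show ?thesis using d(1) by blast
  qed
  then show ?thesis unfolding closed_open open_contains_ball by blast
qed

text \<open>The outer boundary of a bounded cluster of good cells is connected (unicoherence of the
  space), is covered by bad cells, and meets the axis \<open>e\<close> on both sides of the origin.\<close>

lemma bounded_cluster_bad_path:
  fixes e :: "'a::euclidean_space"
  assumes dim: "2 \<le> DIM('a)" and V: "V \<subseteq> lattice" and e: "e \<in> Basis"
    and np: "\<not> percolates (\<Union>z\<in>V. unit_cell z)"
  shows "\<exists>m. \<exists>p\<in>lattice_paths (Suc m) (real m *\<^sub>R e). distinct p \<and> set p \<subseteq> lattice - V"
proof (cases "0 \<in> V")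
  case False
  have "[0::'a] \<in> lattice_paths (Suc (length ([]::'a list))) 0"
    by (rule lattice_pathsI) (auto simp: lattice_def)
  then show ?thesis using False by (intro exI[of _ 0] bexI[of _ "[0]"]) (auto simp: lattice_def)
next
  case True
  \<comment> \<open>The centre of the cell at the origin. Its coordinates lie strictly between
    integers, so the line through \<open>c\<close> along \<open>e\<close> stays in one column of
    cells.\<close>
  define c :: 'a where "c = (1/2) *\<^sub>R One"
  define G where "G = (\<Union>z\<in>V. unit_cell z)"
  define T where "T = connected_component_set G c"
  have c: "c \<bullet> b = 1/2" if "b \<in> Basis" for b using that by (simp add: c_def)
  have "c \<in> unit_cell 0" by (auto simp: mem_unit_cell c)
  then have "c \<in> G" using True by (auto simp: G_def)
  then have T: "c \<in> T" "T \<subseteq> G" "connected T" "closed T"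
    using closed_Union_unit_cells[OF V]
    by (auto simp: T_def connected_component_subset closed_connected_component G_def)
  then have bT: "bounded T" using np by (auto simp: percolates_def G_def)
  let ?O = "outside T"
  \<comment> \<open>Dimension at least two enters here: the outside of a bounded connected set is
    connected, hence one component of the complement, and the frontier of such a component is
    connected.\<close>
  have conO: "connected ?O" by (rule connected_outside[OF bT dim])
  have "?O \<noteq> {}" by (simp add: bT outside_bounded_nonempty)
  then have "?O \<in> components (- T)" using conO by (simp add: outside_in_components)
  then have conF: "connected (frontier ?O)" by (rule connected_frontier_component_complement[OF T(3)])
  have FT: "frontier ?O \<subseteq> T" by (rule frontier_outside_subset[OF T(4)])
  \<comment> \<open>Arbitrarily close to \<open>x\<close> there is an outside point
    \<open>y\<close>. A cell containing \<open>y\<close> also contains \<open>x\<close>; were it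
    good, it would join \<open>y\<close> to \<open>T\<close> through \<open>x\<close>.\<close>
  have "\<exists>z\<in>lattice - V. x \<in> unit_cell z" if x: "x \<in> frontier ?O" for x
  proof -
    obtain d where d: "0 < d" "\<And>y z. z \<in> lattice \<Longrightarrow> dist x y < d \<Longrightarrow> y \<in> unit_cell z \<Longrightarrow> x \<in> unit_cell z"
      using unit_cell_nearby[of x] by blast
    obtain y where y: "y \<in> ?O" "dist x y < d"
      using x d(1) unfolding frontier_straddle by blast
    have yT: "y \<notin> T" using y(1) outside_no_overlap[of T] by blast
    have xy: "x \<in> unit_cell (lattice_floor y)"
      using d(2)[of "lattice_floor y" y] y(2) unit_cell_lattice_floor[of y] by simp
    have "lattice_floor y \<notin> V"
    proof
      assume "lattice_floor y \<in> V"
      then have "unit_cell (lattice_floor y) \<subseteq> G" by (auto simp: G_def)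
      moreover have "connected (unit_cell (lattice_floor y))"
        by (simp add: unit_cell_def convex_connected)
      ultimately have "connected_component G x y"
        using xy unit_cell_lattice_floor by (auto simp: connected_component_def)
      moreover have "connected_component G c x" using x FT by (auto simp: T_def)
      ultimately show False using yT connected_component_trans by (auto simp: T_def)
    qed
    then show ?thesis using xy by (intro bexI[of _ "lattice_floor y"]) auto
  qed
  then obtain f where f: "\<And>x. x \<in> frontier ?O \<Longrightarrow> f x \<in> lattice - V"
    "\<And>x. x \<in> frontier ?O \<Longrightarrow> x \<in> unit_cell (f x)" by metis
  \<comment> \<open>The ray starts in \<open>T\<close> and leaves every bounded set, so it meets the
    frontier of the outside; \<open>s\<close> selects the half-axis.\<close>
  have ray: "\<exists>t\<ge>0. c + (t * s) *\<^sub>R e \<in> frontier ?O" if s: "\<bar>s\<bar> = 1" for s :: real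
  proof -
    let ?r = "(\<lambda>t. c + (t * s) *\<^sub>R e) ` {0..}"
    have "connected ?r" by (intro connected_continuous_image continuous_intros) auto
    moreover have "?r - ?O \<noteq> {}"
    proof -
      have "c \<notin> ?O" using T(1) outside_no_overlap[of T] by blast
      moreover have "c \<in> ?r" by (intro image_eqI[of _ _ 0]) auto
      ultimately show ?thesis by blast
    qed
    moreover have "?r \<inter> ?O \<noteq> {}"
    proof -
      obtain R where R: "\<And>x. x \<in> - ?O \<Longrightarrow> norm x \<le> R"
        using cobounded_outside[OF bT] by (auto simp: bounded_iff)
      define t where "t = \<bar>R\<bar> + norm c + 1"
      have "norm ((t * s) *\<^sub>R e) = t" using s e by (simp add: t_def abs_mult)
      then have "norm (c + (t * s) *\<^sub>R e) > R"
        using norm_diff_ineq[of "(t * s) *\<^sub>R e" c] by (simp add: t_def add.commute)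
      then have "c + (t * s) *\<^sub>R e \<in> ?O" using R by force
      moreover have "t \<ge> 0" by (simp add: t_def)
      ultimately show ?thesis by auto
    qed
    ultimately have "?r \<inter> frontier ?O \<noteq> {}" by (intro connected_Int_frontier) auto
    then show ?thesis by auto
  qed
  obtain t where t: "t \<ge> 0" "c + t *\<^sub>R e \<in> frontier ?O" using ray[of 1] by auto
  obtain t' where t': "t' \<ge> 0" "c - t' *\<^sub>R e \<in> frontier ?O" using ray[of "-1"] by auto
  define x where "x = c + t *\<^sub>R e"
  define x' where "x' = c - t' *\<^sub>R e"
  have fl: "f x \<in> lattice" "f x' \<in> lattice" using f t t' by (auto simp: x_def x'_def)
  have fx: "f x \<bullet> b \<le> x \<bullet> b" "x \<bullet> b \<le> f x \<bullet> b + 1" and fx': "f x' \<bullet> b \<le> x' \<bullet> b" if "b \<in> Basis" for b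
    using f(2) t t' that by (auto simp: x_def x'_def mem_unit_cell)
  have int: "\<exists>i. f x \<bullet> b = of_int i" "\<exists>i. f x' \<bullet> b = of_int i" if "b \<in> Basis" for b
    using fl that by (auto simp: lattice_def Ints_def)
  obtain m' where m': "f x \<bullet> e = of_int m'" using int[OF e] by blast
  have "x \<bullet> e \<ge> 1/2" using t e by (simp add: x_def inner_add_left c)
  \<comment> \<open>From \<open>1/2 \<le> x \<bullet> e \<le> m' + 1\<close> and
    integrality.\<close>
  then have "m' \<ge> 0" using fx(2)[OF e] m' by linarith
  then obtain m where m: "f x \<bullet> e = real m" using m' by (metis of_int_of_nat_eq nonneg_int_cases)
  have fxm: "f x = real m *\<^sub>R e"
  proof (rule euclidean_eqI)
    fix b :: 'a assume b: "b \<in> Basis"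
    show "f x \<bullet> b = (real m *\<^sub>R e) \<bullet> b"
    proof (cases "b = e")
      case True
      then show ?thesis using m e by simp
    next
      case False
      then have "x \<bullet> b = 1/2" using b e by (simp add: x_def inner_add_left c inner_not_same_Basis)
      moreover obtain i where "f x \<bullet> b = of_int i" using int[OF b] by blast
      \<comment> \<open>A coordinate equal to 1/2 forces the integer corner coordinate to be 0, so
        the bad cell at \<open>x\<close> lies on the axis.\<close>
      ultimately have "f x \<bullet> b = 0" using fx[OF b] by simp
      then show ?thesis using False b e by (simp add: inner_not_same_Basis)
    qed
  qed
  have "x' \<bullet> e \<le> 1/2" using t' e by (simp add: x'_def inner_diff_left c)
  moreover obtain j where "f x' \<bullet> e = of_int j" using int[OF e] by blast
  ultimately have "f x' \<bullet> e \<le> 0" using fx'[OF e] by simp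
  \<comment> \<open>The frontier also meets the opposite half-axis, in a cell with nonpositive
    \<open>e\<close>-coordinate; this gap of at least \<open>m\<close> forces \<open>m + 1\<close>
    bad cells.\<close>
  then have dist: "real m \<le> \<bar>f x \<bullet> e - f x' \<bullet> e\<bar>" using m by simp
  have "lattice_adj (f y) (f z)"
    if yz: "y \<in> frontier ?O" "z \<in> frontier ?O" "dist y z < 1" for y z
  proof (rule lattice_adjI)
    show "f y \<in> lattice" "f z \<in> lattice" using f yz by auto
    fix b :: 'a assume b: "b \<in> Basis"
    have "\<bar>y \<bullet> b - z \<bullet> b\<bar> < 1"
      using Basis_le_norm[OF b, of "y - z"] yz(3) by (simp add: dist_norm inner_diff_left)
    moreover have "f y \<bullet> b \<le> y \<bullet> b" "y \<bullet> b \<le> f y \<bullet> b + 1" "f z \<bullet> b \<le> z \<bullet> b" "z \<bullet> b \<le> f z \<bullet> b + 1"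
      using f(2)[OF yz(1)] f(2)[OF yz(2)] b by (auto simp: mem_unit_cell)
    ultimately show "\<bar>f y \<bullet> b - f z \<bullet> b\<bar> < 2" by linarith
  qed
  moreover have "x \<in> frontier ?O" "x' \<in> frontier ?O" using t t' by (auto simp: x_def x'_def)
  moreover have "f ` frontier ?O \<subseteq> lattice - V" using f(1) by blast
  ultimately have "\<exists>p\<in>lattice_paths (Suc m) (f x). distinct p \<and> set p \<subseteq> lattice - V"
    using connected_lattice_path[of "frontier ?O" x x' 1 f "lattice - V" e m] conF e dist by auto
  then show ?thesis using fxm by auto
qed

section \<open>Partitions of space into half-open cubes\<close>

section \<open>Scaled cells\<close>

text \<open>Fibres of a rounding map, so disjointness is immediate; for \<open>z\<close> in the
  lattice, a half-open cube of side \<open>s\<close> with lowest corner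
  \<open>s *\<^sub>R z\<close>.\<close>

definition scaled_cell :: "real \<Rightarrow> 'a::euclidean_space \<Rightarrow> 'a set" where
  "scaled_cell s z = {x. lattice_floor (x /\<^sub>R s) = z}"

lemma mem_scaled_cell:
  assumes "0 < s" "z \<in> lattice"
  shows "x \<in> scaled_cell s z \<longleftrightarrow> (\<forall>b\<in>Basis. s * (z \<bullet> b) \<le> x \<bullet> b \<and> x \<bullet> b < s * (z \<bullet> b) + s)"
proof -
  have "x \<in> scaled_cell s z \<longleftrightarrow> (\<forall>b\<in>Basis. of_int \<lfloor>x \<bullet> b / s\<rfloor> = z \<bullet> b)"
    by (auto simp: scaled_cell_def euclidean_eq_iff[where 'a='a] inverse_eq_divide)
  also have "\<dots> \<longleftrightarrow> (\<forall>b\<in>Basis. s * (z \<bullet> b) \<le> x \<bullet> b \<and> x \<bullet> b < s * (z \<bullet> b) + s)"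
  proof (intro ball_cong refl)
    fix b :: 'a assume "b \<in> Basis"
    then obtain i where i: "z \<bullet> b = of_int i" using assms(2) by (auto simp: lattice_def Ints_def)
    have "of_int \<lfloor>x \<bullet> b / s\<rfloor> = z \<bullet> b \<longleftrightarrow> of_int i \<le> x \<bullet> b / s \<and> x \<bullet> b / s < of_int i + 1"
      by (simp add: i floor_eq_iff)
    also have "\<dots> \<longleftrightarrow> s * of_int i \<le> x \<bullet> b \<and> x \<bullet> b < s * of_int i + s"
      using assms(1) by (simp add: field_simps)
    finally show "of_int \<lfloor>x \<bullet> b / s\<rfloor> = z \<bullet> b \<longleftrightarrow> s * (z \<bullet> b) \<le> x \<bullet> b \<and> x \<bullet> b < s * (z \<bullet> b) + s"
      by (simp add: i)
  qed
  finally show ?thesis .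
qed

lemma scaled_cell_subset_cbox:
  assumes "0 < s" "z \<in> lattice"
  shows "scaled_cell s z \<subseteq> cbox (s *\<^sub>R z) (s *\<^sub>R z + s *\<^sub>R One)"
  using mem_scaled_cell[OF assms] by (auto simp: mem_box inner_add_left less_imp_le)

lemma bounded_scaled_cell:
  assumes "0 < s" "z \<in> lattice"
  shows "bounded (scaled_cell s z)"
  using bounded_subset[OF bounded_cbox scaled_cell_subset_cbox[OF assms]] .

lemma scaled_cell_borel:
  assumes "0 < s" "z \<in> lattice"
  shows "scaled_cell s z \<in> sets borel"
proof -
  have "scaled_cell s z = (\<Inter>b\<in>Basis. {x. s * (z \<bullet> b) \<le> x \<bullet> b} \<inter> {x. x \<bullet> b < s * (z \<bullet> b) + s})"
    using mem_scaled_cell[OF assms] by auto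
  also have "\<dots> \<in> sets borel"
    by (intro sets.finite_INT sets.Int borel_closed borel_open closed_Collect_le open_Collect_less
        continuous_intros) auto
  finally show ?thesis .
qed

text \<open>The cell is squeezed between an open and a closed box of equal volume.\<close>

lemma emeasure_scaled_cell:
  assumes "0 < s" "z \<in> lattice"
  shows "emeasure lborel (scaled_cell s (z::'a::euclidean_space)) = ennreal (s ^ DIM('a))"
proof -
  let ?a = "s *\<^sub>R z" and ?b = "s *\<^sub>R z + s *\<^sub>R One"
  have "box ?a ?b \<subseteq> scaled_cell s z"
    using mem_scaled_cell[OF assms] by (auto simp: mem_box inner_add_left less_imp_le)
  then have "emeasure lborel (box ?a ?b) \<le> emeasure lborel (scaled_cell s z)"
    using scaled_cell_borel[OF assms] by (intro emeasure_mono) auto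
  moreover have "emeasure lborel (scaled_cell s z) \<le> emeasure lborel (cbox ?a ?b)"
    by (intro emeasure_mono scaled_cell_subset_cbox assms) auto
  ultimately show ?thesis
    using assms(1) by (simp add: emeasure_lborel_cbox_eq emeasure_lborel_box_eq inner_add_left)
qed

lemma disjoint_scaled_cells: "disjoint_family_on (scaled_cell s) V"
  by (auto simp: disjoint_family_on_def scaled_cell_def)

lemma countable_lattice: "countable (lattice :: 'a::euclidean_space set)"
proof -
  have "(lattice :: 'a set) \<subseteq> (\<Union>n::nat. {z \<in> lattice. norm z \<le> real n})"
    using real_arch_simple by auto
  then show ?thesis
    by (rule countable_subset) (auto intro: countable_finite finite_lattice_bounded)
qed

section \<open>First-moment bound on occupied paths\<close>

section \<open>The subcritical regime\<close>

text \<open>Each covered point is sent to the cell of an atom within distance \<open>r\<close>. As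
  \<open>S\<close> is unbounded, so is the set of these cells. One starting cell serves every
  \<open>n\<close>, which later allows intersecting over \<open>n\<close>.\<close>

lemma percolates_occupied_paths:
  fixes \<mu> :: "'a::euclidean_space measure"
  assumes \<mu>: "\<mu> \<in> radon_counting_measures" and r: "0 \<le> r" "2 * r < s"
    and perc: "percolates (covered_set 1 \<mu> r)"
  shows "\<exists>u\<in>lattice. \<forall>n. \<exists>p\<in>lattice_paths (Suc n) u. distinct p \<and>
    set p \<subseteq> {z \<in> lattice. emeasure \<mu> (scaled_cell s z) \<noteq> 0}"
proof -
  have s: "s > 0" using r by linarith
  obtain S where S: "S \<subseteq> covered_set 1 \<mu> r" "connected S" "\<not> bounded S"
    using perc by (auto simp: percolates_def)
  have "\<exists>x. dist y x \<le> r \<and> emeasure \<mu> {x} \<noteq> 0" if "y \<in> S" for y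
    using covered_set_atom[OF \<mu>, of y r] S(1) that by blast
  then obtain a where a: "\<And>y. y \<in> S \<Longrightarrow> dist y (a y) \<le> r" "\<And>y. y \<in> S \<Longrightarrow> emeasure \<mu> {a y} \<noteq> 0"
    by metis
  define f where "f y = lattice_floor (a y /\<^sub>R s)" for y
  let ?V = "{z \<in> lattice. emeasure \<mu> (scaled_cell s z) \<noteq> 0}"
  have fV: "f ` S \<subseteq> ?V"
  proof (rule image_subsetI)
    fix y assume y: "y \<in> S"
    have fl: "f y \<in> lattice" by (simp add: f_def)
    have "emeasure \<mu> {a y} \<le> emeasure \<mu> (scaled_cell s (f y))"
      using scaled_cell_borel[OF s fl] radon_counting_measures_sets[OF \<mu>]
      by (intro emeasure_mono) (auto simp: f_def scaled_cell_def)
    then show "f y \<in> ?V" using a(2)[OF y] fl by auto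
  qed
  \<comment> \<open>Moving to the atoms costs at most \<open>r\<close> at each end, so points closer
    than \<open>s - 2 * r\<close> have atoms closer than one side length.\<close>
  have adj: "lattice_adj (f y) (f z)" if yz: "y \<in> S" "z \<in> S" "dist y z < s - 2 * r" for y z
  proof (rule lattice_adjI)
    fix b :: 'a assume b: "b \<in> Basis"
    have "dist (a y) (a z) \<le> dist y (a y) + dist y z + dist z (a z)"
      using dist_triangle[of "a y" "a z" y] dist_triangle[of y "a z" z] by (simp add: dist_commute)
    also have "\<dots> < s" using a(1)[OF yz(1)] a(1)[OF yz(2)] yz(3) by linarith
    finally have "\<bar>a y \<bullet> b - a z \<bullet> b\<bar> < s"
      using Basis_le_norm[OF b, of "a y - a z"] by (simp add: dist_norm inner_diff_left)
    then have "\<bar>a y \<bullet> b - a z \<bullet> b\<bar> / s < 1" using s by simp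
    then have "\<bar>(a y \<bullet> b) / s - (a z \<bullet> b) / s\<bar> < 1" using s by (simp add: diff_divide_distrib[symmetric])
    then have "\<bar>real_of_int \<lfloor>a y \<bullet> b / s\<rfloor> - real_of_int \<lfloor>a z \<bullet> b / s\<rfloor>\<bar> < 2" by linarith
    then show "\<bar>f y \<bullet> b - f z \<bullet> b\<bar> < 2" using b by (simp add: f_def inverse_eq_divide)
  qed (simp_all add: f_def)
  obtain x where x: "x \<in> S" using S(3) by fastforce
  have "\<exists>p\<in>lattice_paths (Suc n) (f x). distinct p \<and> set p \<subseteq> ?V" for n
  proof -
    have "\<exists>y\<in>S. \<exists>b\<in>Basis. real n \<le> \<bar>f x \<bullet> b - f y \<bullet> b\<bar>"
    proof (rule ccontr)
      assume "\<not> ?thesis"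
      then have small: "\<bar>f x \<bullet> b - f y \<bullet> b\<bar> \<le> real n" if "y \<in> S" "b \<in> Basis" for y b
        using that by fastforce
      have "norm y \<le> r + s * (norm (f x) + DIM('a) * real n + DIM('a))" if y: "y \<in> S" for y
      proof -
        have "(\<Sum>b\<in>Basis. \<bar>(f x - f y) \<bullet> b\<bar>) \<le> of_nat DIM('a) * real n"
          using small[OF y] by (intro sum_bounded_above) (simp add: inner_diff_left)
        then have 1: "norm (f y) \<le> norm (f x) + DIM('a) * real n"
          using norm_le_l1[of "f x - f y"] norm_triangle_ineq2[of "f y" "f x"]
          by (simp add: norm_minus_commute)
        have "f y \<in> unit_cell (f y)" by (simp add: mem_unit_cell)
        then have "norm (a y /\<^sub>R s - f y) \<le> DIM('a)"
          using unit_cell_lattice_floor[of "a y /\<^sub>R s"] norm_diff_unit_cell by (auto simp: f_def)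
        then have "norm (a y /\<^sub>R s) \<le> norm (f x) + DIM('a) * real n + DIM('a)"
          using 1 norm_triangle_ineq2[of "a y /\<^sub>R s" "f y"] by linarith
        then have "s * norm (a y /\<^sub>R s) \<le> s * (norm (f x) + DIM('a) * real n + DIM('a))"
          using s by (intro mult_left_mono) auto
        moreover have "s * norm (a y /\<^sub>R s) = norm (a y)" using s by simp
        ultimately have "norm (a y) \<le> s * (norm (f x) + DIM('a) * real n + DIM('a))" by metis
        then show ?thesis
          using a(1)[OF y] norm_triangle_ineq2[of y "a y"] by (simp add: dist_norm)
      qed
      then show False using S(3) unfolding bounded_iff by blast
    qed
    then obtain y b where yb: "y \<in> S" "b \<in> Basis" "real n \<le> \<bar>f x \<bullet> b - f y \<bullet> b\<bar>" by blast
    show ?thesis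
      by (rule connected_lattice_path[OF S(2) x yb(1) _ adj fV _ yb(2,3)]) (use r in auto)
  qed
  moreover have "f x \<in> lattice" by (simp add: f_def)
  ultimately show ?thesis by blast
qed

lemma all_occupied_measurable:
  fixes p :: "'a::euclidean_space list"
  assumes "point_process M \<Phi>" "0 < s" "set p \<subseteq> lattice"
  shows "{\<omega> \<in> space M. \<forall>z\<in>set p. emeasure (\<Phi> \<omega>) (scaled_cell s z) \<noteq> 0} \<in> sets M"
proof (cases "p = []")
  case False
  then show ?thesis using assms(3)
    by (intro sets.sets_Collect_finite_All' occupied_event_measurable scaled_cell_borel assms(1,2)) auto
qed simp

text \<open>Markov's inequality: on the event every count is at least 1, so the product of counts
  dominates the indicator. Distinct vertices give disjoint cells, to which the moment bound
  applies.\<close>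

lemma emeasure_all_occupied_le:
  fixes \<Phi> :: "'w \<Rightarrow> 'a::euclidean_space measure" and l r s :: real
  assumes pp: "point_process M \<Phi>" and alpha: "alpha_weakly_sub_poisson M \<Phi>"
    and int: "has_intensity M \<Phi> l" and s: "0 < s"
    and p: "p \<noteq> []" "distinct p" "set p \<subseteq> lattice"
  shows "emeasure M {\<omega> \<in> space M. \<forall>z\<in>set p. emeasure (\<Phi> \<omega>) (scaled_cell s z) \<noteq> 0}
    \<le> ennreal ((l * s ^ DIM('a)) ^ length p)"
proof -
  define n where "n = length p"
  \<comment> \<open>The moment condition is indexed from 1, lists from 0.\<close>
  define B where "B i = scaled_cell s (p ! (i - 1))" for i
  have n: "n \<ge> 1" using p(1) by (cases p) (auto simp: n_def)
  have pl: "p ! (i - 1) \<in> set p" if "i \<in> {1..n}" for i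
    using that by (intro nth_mem) (auto simp: n_def)
  have l: "0 < l" using int by (simp add: has_intensity_def)
  have B: "B i \<in> sets borel" "bounded (B i)" if "i \<in> {1..n}" for i
    using pl[OF that] p(3) s by (auto simp: B_def intro!: scaled_cell_borel bounded_scaled_cell)
  note rad = point_process_radon[OF pp]
  let ?E = "{\<omega> \<in> space M. \<forall>z\<in>set p. emeasure (\<Phi> \<omega>) (scaled_cell s z) \<noteq> 0}"
  have Em: "?E \<in> sets M" by (rule all_occupied_measurable[OF pp s p(3)])
  have "emeasure M ?E = (\<integral>\<^sup>+\<omega>. indicator ?E \<omega> \<partial>M)" using Em by simp
  also have "\<dots> \<le> (\<integral>\<^sup>+\<omega>. (\<Prod>i\<in>{1..n}. emeasure (\<Phi> \<omega>) (B i)) \<partial>M)"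
  proof (rule nn_integral_mono)
    fix \<omega> assume \<omega>: "\<omega> \<in> space M"
    show "indicator ?E \<omega> \<le> (\<Prod>i\<in>{1..n}. emeasure (\<Phi> \<omega>) (B i))"
    proof (cases "\<omega> \<in> ?E")
      case True
      then have "1 \<le> emeasure (\<Phi> \<omega>) (B i)" if "i \<in> {1..n}" for i
        using radon_counting_measures_nat[OF rad[OF \<omega>] B(1)[OF that]] pl[OF that]
        by (auto simp: B_def)
      then have "(\<Prod>i\<in>{1..n}. 1) \<le> (\<Prod>i\<in>{1..n}. emeasure (\<Phi> \<omega>) (B i))"
        by (rule prod_mono_ennreal)
      then show ?thesis using True by simp
    qed simp
  qed
  also have "\<dots> \<le> (\<Prod>i\<in>{1..n}. mean_count M \<Phi> (B i))"
  proof -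
    have "disjoint_family_on B {1..n}"
      unfolding disjoint_family_on_def
    proof (intro ballI impI)
      fix i j assume "i \<in> {1..n}" "j \<in> {1..n}" "i \<noteq> j"
      then have "p ! (i - 1) \<noteq> p ! (j - 1)"
        using p(2) by (subst nth_eq_iff_index_eq) (auto simp: n_def)
      then show "B i \<inter> B j = {}" by (auto simp: B_def scaled_cell_def)
    qed
    then show ?thesis using alpha n B unfolding alpha_weakly_sub_poisson_def by blast
  qed
  also have "\<dots> = (\<Prod>i\<in>{1..n}. ennreal (l * s ^ DIM('a)))"
  proof (rule prod.cong[OF refl])
    fix i assume i: "i \<in> {1..n}"
    have "mean_count M \<Phi> (B i) = ennreal l * emeasure lborel (B i)"
      using int B(1)[OF i] by (simp add: has_intensity_def)
    also have "\<dots> = ennreal l * ennreal (s ^ DIM('a))"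
      using pl[OF i] p(3) by (subst emeasure_scaled_cell[OF s, symmetric, of "p ! (i - 1)"]) (auto simp: B_def)
    finally show "mean_count M \<Phi> (B i) = ennreal (l * s ^ DIM('a))"
      using l s by (simp add: ennreal_mult)
  qed
  also have "\<dots> = ennreal ((l * s ^ DIM('a)) ^ n)"
    using l s by (simp add: ennreal_power)
  finally show ?thesis by (simp add: n_def)
qed

text \<open>For a fixed start, the union bound over paths with \<open>Suc n\<close> vertices gives
  at most \<open>(1/2) ^ Suc n\<close>. Percolation demands such paths for all \<open>n\<close> from
  some start, hence lies in a countable union of null sets.\<close>

lemma no_percolation_small_radius:
  fixes \<Phi> :: "'w \<Rightarrow> 'a::euclidean_space measure" and l r s :: real
  assumes pp: "point_process M \<Phi>" and alpha: "alpha_weakly_sub_poisson M \<Phi>"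
    and int: "has_intensity M \<Phi> l"
    and r: "0 \<le> r" "2 * r < s"
    and s: "card (lattice_steps :: 'a set) * (l * s ^ DIM('a)) \<le> 1 / 2"
  shows "measure M {\<omega> \<in> space M. percolates (covered_set 1 (\<Phi> \<omega>) r)} = 0"
proof -
  have s0: "s > 0" using r by linarith
  have l: "0 < l" using int by (simp add: has_intensity_def)
  note rad = point_process_radon[OF pp]
  let ?K = "card (lattice_steps :: 'a set)"
  define F where "F p = {\<omega> \<in> space M. \<forall>z\<in>set p. emeasure (\<Phi> \<omega>) (scaled_cell s z) \<noteq> 0}" for p
  define P where "P n u = {p \<in> lattice_paths n u. distinct p \<and> set p \<subseteq> lattice}" for n and u :: 'a
  have finP: "finite (P n u)" for n u by (simp add: P_def finite_lattice_paths)
  have F_meas: "F p \<in> sets M" if "set p \<subseteq> lattice" for p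
    unfolding F_def by (rule all_occupied_measurable[OF pp s0 that])
  define E where "E n u = (\<Union>p\<in>P n u. F p)" for n u
  have E_meas: "E n u \<in> sets M" for n u
    unfolding E_def using F_meas by (intro sets.finite_UN finP) (auto simp: P_def)
  have E_le: "emeasure M (E (Suc n) u) \<le> ennreal ((1/2) ^ Suc n)" for n u
  proof -
    have "emeasure M (E (Suc n) u) \<le> (\<Sum>p\<in>P (Suc n) u. emeasure M (F p))"
      unfolding E_def using F_meas by (intro emeasure_subadditive_finite finP) (auto simp: P_def)
    also have "\<dots> \<le> (\<Sum>p\<in>P (Suc n) u. ennreal ((l * s ^ DIM('a)) ^ Suc n))"
    proof (rule sum_mono)
      fix p assume p: "p \<in> P (Suc n) u"
      then have "length p = Suc n" by (auto simp: P_def dest: length_lattice_paths)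
      moreover from this have "p \<noteq> []" by auto
      ultimately show "emeasure M (F p) \<le> ennreal ((l * s ^ DIM('a)) ^ Suc n)"
        using emeasure_all_occupied_le[OF pp alpha int s0, of p] p by (simp add: F_def P_def)
    qed
    also have "\<dots> = ennreal (card (P (Suc n) u) * (l * s ^ DIM('a)) ^ Suc n)"
      using l s0 by (simp add: ennreal_mult ennreal_of_nat_eq_real_of_nat)
    also have "\<dots> \<le> ennreal ((1/2) ^ Suc n)"
    proof (rule ennreal_leI)
      have "P (Suc n) u \<subseteq> lattice_paths (Suc n) u" by (auto simp: P_def)
      then have "card (P (Suc n) u) \<le> ?K ^ Suc n"
        by (rule order.trans[OF card_mono[OF finite_lattice_paths] card_lattice_paths])
      then have "real (card (P (Suc n) u)) \<le> real ?K ^ Suc n"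
        unfolding of_nat_power[symmetric] by (rule of_nat_mono)
      then have "real (card (P (Suc n) u)) * (l * s ^ DIM('a)) ^ Suc n \<le> real ?K ^ Suc n * (l * s ^ DIM('a)) ^ Suc n"
        using l s0 by (intro mult_right_mono) auto
      also have "\<dots> = (real ?K * (l * s ^ DIM('a))) ^ Suc n" by (simp add: power_mult_distrib)
      also have "\<dots> \<le> (1/2) ^ Suc n" using s l s0 by (intro power_mono) auto
      finally show "real (card (P (Suc n) u)) * (l * s ^ DIM('a)) ^ Suc n \<le> (1/2) ^ Suc n" .
    qed
    finally show ?thesis .
  qed
  have null: "(\<Inter>n. E (Suc n) u) \<in> null_sets M" for u
  proof -
    have m: "(\<Inter>n. E (Suc n) u) \<in> sets M" using E_meas by (intro sets.countable_INT) auto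
    have "emeasure M (\<Inter>n. E (Suc n) u) \<le> ennreal ((1/2) ^ Suc n)" for n
      by (rule order.trans[OF emeasure_mono E_le[of n u]]) (use E_meas in auto)
    moreover have "(\<lambda>n. ennreal ((1/2) ^ Suc n)) \<longlonglongrightarrow> ennreal 0"
      by (intro tendsto_ennrealI LIMSEQ_Suc LIMSEQ_power_zero) auto
    ultimately have "emeasure M (\<Inter>n. E (Suc n) u) \<le> ennreal 0"
      by (intro LIMSEQ_le_const) auto
    then show ?thesis using m by auto
  qed
  have N: "(\<Union>u\<in>lattice. \<Inter>n. E (Suc n) u) \<in> null_sets M"
    using null by (intro null_sets_UN' countable_lattice)
  have "{\<omega> \<in> space M. percolates (covered_set 1 (\<Phi> \<omega>) r)} \<subseteq> (\<Union>u\<in>lattice. \<Inter>n. E (Suc n) u)"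
  proof clarify
    fix \<omega> assume \<omega>: "\<omega> \<in> space M" "percolates (covered_set 1 (\<Phi> \<omega>) r)"
    obtain u where u: "u \<in> lattice" "\<And>n. \<exists>p\<in>lattice_paths (Suc n) u. distinct p \<and>
        set p \<subseteq> {z \<in> lattice. emeasure (\<Phi> \<omega>) (scaled_cell s z) \<noteq> 0}"
      using percolates_occupied_paths[OF rad[OF \<omega>(1)] r \<omega>(2)] by blast
    have "\<omega> \<in> E (Suc n) u" for n
      using u(2)[of n] \<omega>(1) unfolding E_def P_def F_def by (auto simp del: lattice_paths.simps)
    then show "\<omega> \<in> (\<Union>u\<in>lattice. \<Inter>n. E (Suc n) u)" using u(1) by auto
  qed
  then have "emeasure M {\<omega> \<in> space M. percolates (covered_set 1 (\<Phi> \<omega>) r)} = 0"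
    using N by (meson emeasure_eq_0 null_setsD1 null_setsD2)
  then show ?thesis by (simp add: measure_def)
qed

section \<open>Void-probability bound on bad paths\<close>

section \<open>The supercritical regime\<close>

text \<open>The coarse cell of side \<open>k * u\<close> at \<open>z\<close> contains the \<open>k\<close> disjoint fine cells of side \<open>u\<close> used here,
  so a good coarse cell carries at least \<open>k\<close> points, although only void probabilities are
  controlled.\<close>

definition good_cells :: "'a::euclidean_space \<Rightarrow> real \<Rightarrow> nat \<Rightarrow> 'a measure \<Rightarrow> 'a set" where
  "good_cells e u k \<mu> = {z \<in> lattice. \<forall>j<k. emeasure \<mu> (scaled_cell u (real k *\<^sub>R z + real j *\<^sub>R e)) \<noteq> 0}"

lemma fine_cell_lattice:
  assumes "e \<in> Basis" "z \<in> lattice"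
  shows "real k *\<^sub>R z + real j *\<^sub>R e \<in> lattice"
  using assms by (auto simp: lattice_def inner_add_left inner_Basis)

text \<open>The \<open>e\<close>-coordinate modulo \<open>k\<close> recovers the offset
  \<open>j\<close>, and then \<open>z\<close> follows by cancellation.\<close>

lemma fine_cell_inj:
  assumes e: "e \<in> Basis" and z: "z \<in> lattice" "z' \<in> lattice" and j: "j < k" "j' < k"
    and eq: "real k *\<^sub>R z + real j *\<^sub>R e = real k *\<^sub>R z' + real j' *\<^sub>R e"
  shows "z = z' \<and> j = j'"
proof -
  have *: "real k * (z \<bullet> b) + real j * (e \<bullet> b) = real k * (z' \<bullet> b) + real j' * (e \<bullet> b)" for b
    using arg_cong[OF eq, of "\<lambda>x. x \<bullet> b"] by (simp add: inner_add_left)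
  obtain i where i: "z \<bullet> e = of_int i" using z(1) e by (auto simp: lattice_def Ints_def)
  obtain i' where i': "z' \<bullet> e = of_int i'" using z(2) e by (auto simp: lattice_def Ints_def)
  have "real_of_int (int k * i + int j) = real_of_int (int k * i' + int j')"
    using *[of e] e i i' by simp
  then have "int k * i + int j = int k * i' + int j'" by linarith
  then have "(int j + int k * i) mod int k = (int j' + int k * i') mod int k" by (simp add: add.commute)
  then have "j = j'" using j by simp
  moreover from this eq have "z = z'" using j by simp
  ultimately show ?thesis by simp
qed

text \<open>After scaling by the coarse side \<open>s = k * u\<close>, a ball of radius
  \<open>s * DIM('a)\<close> around any point of a good cell contains its \<open>k\<close> disjoint
  occupied fine cells, so their masses add up to at least \<open>k\<close>.\<close>

lemma percolates_good_cells_covered: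
  fixes \<mu> :: "'a::euclidean_space measure"
  assumes \<mu>: "\<mu> \<in> radon_counting_measures" and e: "e \<in> Basis" and u: "0 < u" and k: "1 \<le> k"
    and perc: "percolates (\<Union>z\<in>good_cells e u k \<mu>. unit_cell z)"
  shows "percolates (covered_set k \<mu> (real k * u * DIM('a)))"
proof -
  define s where "s = real k * u"
  have s: "s > 0" using u k by (simp add: s_def)
  obtain S where S: "S \<subseteq> (\<Union>z\<in>good_cells e u k \<mu>. unit_cell z)" "connected S" "\<not> bounded S"
    using perc by (auto simp: percolates_def)
  have "connected ((\<lambda>x. s *\<^sub>R x) ` S)"
    by (intro connected_continuous_image continuous_intros S(2))
  moreover have "\<not> bounded ((\<lambda>x. s *\<^sub>R x) ` S)"
  proof
    assume "bounded ((\<lambda>x. s *\<^sub>R x) ` S)"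
    then have "bounded ((\<lambda>x. (1 / s) *\<^sub>R x) ` (\<lambda>x. s *\<^sub>R x) ` S)" by (rule bounded_scaling)
    then show False using S(3) s by (simp add: image_image)
  qed
  moreover have "(\<lambda>x. s *\<^sub>R x) ` S \<subseteq> covered_set k \<mu> (s * DIM('a))"
  proof (rule image_subsetI)
    fix x assume "x \<in> S"
    then obtain z where z: "z \<in> good_cells e u k \<mu>" "x \<in> unit_cell z" using S(1) by blast
    then have zl: "z \<in> lattice" by (simp add: good_cells_def)
    define C where "C j = scaled_cell u (real k *\<^sub>R z + real j *\<^sub>R e)" for j
    have C_borel: "C j \<in> sets borel" for j
      unfolding C_def by (intro scaled_cell_borel u fine_cell_lattice e zl)
    have C_sub: "C j \<subseteq> cball (s *\<^sub>R x) (s * DIM('a))" if j: "j < k" for j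
    proof
      fix y assume "y \<in> C j"
      then have y: "u * (real k * (z \<bullet> b) + real j * (e \<bullet> b)) \<le> y \<bullet> b \<and>
          y \<bullet> b < u * (real k * (z \<bullet> b) + real j * (e \<bullet> b)) + u" if "b \<in> Basis" for b
        using mem_scaled_cell[OF u fine_cell_lattice[OF e zl]] that by (simp add: C_def inner_add_left)
      have "y /\<^sub>R s \<in> unit_cell z"
        unfolding mem_unit_cell
      proof
        fix b :: 'a assume b: "b \<in> Basis"
        \<comment> \<open>Since \<open>j < k\<close>, the fine cell starting at offset
          \<open>j\<close> ends no later than offset \<open>k\<close>, inside the coarse
          cell.\<close>
        have "0 \<le> real j * (e \<bullet> b)" "real j * (e \<bullet> b) + 1 \<le> real k"
          using j e b by (auto simp: inner_Basis)
        then have "0 \<le> u * (real j * (e \<bullet> b))" "u * (real j * (e \<bullet> b) + 1) \<le> u * real k"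
          using u by (auto intro!: mult_left_mono)
        then have "s * (z \<bullet> b) \<le> y \<bullet> b" "y \<bullet> b \<le> s * (z \<bullet> b + 1)"
          using y[OF b] by (auto simp: s_def algebra_simps)
        then show "z \<bullet> b \<le> (y /\<^sub>R s) \<bullet> b \<and> (y /\<^sub>R s) \<bullet> b \<le> z \<bullet> b + 1"
          using s by (simp add: field_simps)
      qed
      then have "norm (x - y /\<^sub>R s) \<le> DIM('a)" by (rule norm_diff_unit_cell[OF z(2)])
      then have "s * norm (x - y /\<^sub>R s) \<le> s * DIM('a)" using s by (intro mult_left_mono) auto
      moreover have "s * norm (x - y /\<^sub>R s) = norm (s *\<^sub>R (x - y /\<^sub>R s))" using s by simp
      moreover have "s *\<^sub>R (x - y /\<^sub>R s) = s *\<^sub>R x - y" using s by (simp add: scaleR_diff_right)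
      ultimately show "y \<in> cball (s *\<^sub>R x) (s * DIM('a))" by (simp add: dist_norm)
    qed
    have "disjoint_family_on C {..<k}"
      unfolding disjoint_family_on_def
    proof (intro ballI impI)
      fix i j assume "i \<in> {..<k}" "j \<in> {..<k}" "i \<noteq> j"
      then show "C i \<inter> C j = {}"
        using fine_cell_inj[OF e zl zl, of i k j] by (auto simp: C_def scaled_cell_def)
    qed
    then have "(\<Sum>j<k. emeasure \<mu> (C j)) = emeasure \<mu> (\<Union>j<k. C j)"
      using C_borel radon_counting_measures_sets[OF \<mu>] by (intro sum_emeasure) auto
    also have "\<dots> \<le> emeasure \<mu> (cball (s *\<^sub>R x) (s * DIM('a)))"
      using C_sub radon_counting_measures_sets[OF \<mu>] by (intro emeasure_mono) auto
    finally have "(\<Sum>j<k. emeasure \<mu> (C j)) \<le> emeasure \<mu> (cball (s *\<^sub>R x) (s * DIM('a)))" .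
    moreover have "(\<Sum>j<k. 1) \<le> (\<Sum>j<k. emeasure \<mu> (C j))"
    proof (rule sum_mono)
      fix j assume "j \<in> {..<k}"
      then show "1 \<le> emeasure \<mu> (C j)"
        using z(1) radon_counting_measures_nat[OF \<mu> C_borel[of j]] by (auto simp: good_cells_def C_def)
    qed
    ultimately show "s *\<^sub>R x \<in> covered_set k \<mu> (s * DIM('a))"
      by (simp add: covered_set_eq[OF \<mu>])
  qed
  ultimately show ?thesis unfolding percolates_def s_def by blast
qed

text \<open>All cells are empty exactly when their union is, and volume is additive over disjoint
  cells; one void bound on the union thus yields a product.\<close>

lemma prob_all_empty_le:
  fixes \<Phi> :: "'w \<Rightarrow> 'a::euclidean_space measure" and l s :: real
  assumes pp: "point_process M \<Phi>" and nu: "nu_weakly_sub_poisson M \<Phi>"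
    and int: "has_intensity M \<Phi> l" and s: "0 < s" and W: "finite W" "W \<subseteq> lattice"
  shows "measure M {\<omega> \<in> space M. \<forall>z\<in>W. emeasure (\<Phi> \<omega>) (scaled_cell s z) = 0}
    \<le> exp (- (l * s ^ DIM('a))) ^ card W"
proof -
  interpret prob_space M using pp by (simp add: point_process_def)
  have l: "0 < l" using int by (simp add: has_intensity_def)
  have cell: "scaled_cell s z \<in> sets borel" if "z \<in> W" for z
    using scaled_cell_borel[OF s] W that by blast
  define B where "B = (\<Union>z\<in>W. scaled_cell s z)"
  have B: "B \<in> sets borel" unfolding B_def using cell by (intro sets.finite_UN W(1)) auto
  have "bounded B" unfolding B_def
    using W bounded_scaled_cell[OF s] by (intro bounded_UN) auto
  have "emeasure lborel B = (\<Sum>z\<in>W. emeasure lborel (scaled_cell s z))"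
    unfolding B_def using cell W(1) disjoint_scaled_cells by (intro sum_emeasure[symmetric]) auto
  also have "\<dots> = (\<Sum>z\<in>W. ennreal (s ^ DIM('a)))"
    using W(2) emeasure_scaled_cell[OF s] by (intro sum.cong) auto
  also have "\<dots> = ennreal (card W * s ^ DIM('a))"
    using s by (simp add: ennreal_mult ennreal_of_nat_eq_real_of_nat)
  finally have "mean_count M \<Phi> B = ennreal (l * (card W * s ^ DIM('a)))"
    using int B l s by (simp add: has_intensity_def ennreal_mult)
  then have "exp_neg (mean_count M \<Phi> B) = exp (- (l * (card W * s ^ DIM('a))))"
    using l s by (simp add: exp_neg_def)
  also have "\<dots> = exp (- (l * s ^ DIM('a))) ^ card W"
    by (simp add: exp_of_nat_mult[symmetric] mult_ac)
  finally have eq: "exp_neg (mean_count M \<Phi> B) = exp (- (l * s ^ DIM('a))) ^ card W" .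
  have "{\<omega> \<in> space M. \<forall>z\<in>W. emeasure (\<Phi> \<omega>) (scaled_cell s z) = 0} \<subseteq>
      {\<omega> \<in> space M. emeasure (\<Phi> \<omega>) B = 0}"
  proof clarify
    fix \<omega> assume \<omega>: "\<omega> \<in> space M" "\<forall>z\<in>W. emeasure (\<Phi> \<omega>) (scaled_cell s z) = 0"
    have "B \<in> null_sets (\<Phi> \<omega>)"
      unfolding B_def
      using \<omega>(2) cell W(1) radon_counting_measures_sets[OF point_process_radon[OF pp \<omega>(1)]]
      by (intro null_sets_UN' countable_finite null_setsI) auto
    then show "emeasure (\<Phi> \<omega>) B = 0" by auto
  qed
  moreover have "{\<omega> \<in> space M. emeasure (\<Phi> \<omega>) B = 0} \<in> sets M"
    using point_process_measurable[OF pp B] by measurable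
  ultimately have "measure M {\<omega> \<in> space M. \<forall>z\<in>W. emeasure (\<Phi> \<omega>) (scaled_cell s z) = 0} \<le>
      measure M {\<omega> \<in> space M. emeasure (\<Phi> \<omega>) B = 0}"
    by (rule finite_measure_mono)
  also have "\<dots> \<le> exp_neg (mean_count M \<Phi> B)"
    using nu B \<open>bounded B\<close> by (simp add: nu_weakly_sub_poisson_def)
  finally show ?thesis by (simp only: eq)
qed

lemma bad_event_measurable:
  assumes pp: "point_process M \<Phi>" and e: "e \<in> Basis" and u: "0 < u" and W: "finite W" "W \<subseteq> lattice"
  shows "{\<omega> \<in> space M. W \<inter> good_cells e u k (\<Phi> \<omega>) = {}} \<in> sets M"
proof -
  have "{\<omega> \<in> space M. z \<in> good_cells e u k (\<Phi> \<omega>)} \<in> sets M" if "z \<in> W" for z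
  proof (cases "k = 0")
    case True
    then show ?thesis using that W by (auto simp: good_cells_def)
  next
    case False
    have "{\<omega> \<in> space M. z \<in> good_cells e u k (\<Phi> \<omega>)} = {\<omega> \<in> space M. \<forall>j\<in>{..<k}.
        emeasure (\<Phi> \<omega>) (scaled_cell u (real k *\<^sub>R z + real j *\<^sub>R e)) \<noteq> 0}"
      using that W by (auto simp: good_cells_def)
    also have "\<dots> \<in> sets M"
      using False that W(2) by (intro sets.sets_Collect_finite_All' occupied_event_measurable[OF pp]
        scaled_cell_borel u fine_cell_lattice e) auto
    finally show ?thesis .
  qed
  then have m: "(\<Union>z\<in>W. {\<omega> \<in> space M. z \<in> good_cells e u k (\<Phi> \<omega>)}) \<in> sets M"
    by (intro sets.finite_UN W(1))
  have "{\<omega> \<in> space M. W \<inter> good_cells e u k (\<Phi> \<omega>) = {}} =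
      space M - (\<Union>z\<in>W. {\<omega> \<in> space M. z \<in> good_cells e u k (\<Phi> \<omega>)})" by auto
  then show ?thesis using m by auto
qed

text \<open>Each bad cell has some empty fine cell. A union bound over the \<open>k ^ card W\<close>
  ways to select one per cell reduces the event to emptiness of prescribed fine cells.\<close>

lemma prob_all_bad_le:
  fixes \<Phi> :: "'w \<Rightarrow> 'a::euclidean_space measure" and l u :: real
  assumes pp: "point_process M \<Phi>" and nu: "nu_weakly_sub_poisson M \<Phi>"
    and int: "has_intensity M \<Phi> l" and e: "e \<in> Basis" and u: "0 < u" and W: "finite W" "W \<subseteq> lattice"
  shows "measure M {\<omega> \<in> space M. W \<inter> good_cells e u k (\<Phi> \<omega>) = {}}
    \<le> (real k * exp (- (l * u ^ DIM('a)))) ^ card W"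
proof -
  interpret prob_space M using pp by (simp add: point_process_def)
  define I where "I = (\<Pi>\<^sub>E z\<in>W. {..<k})"
  define h where "h f z = real k *\<^sub>R z + real (f z) *\<^sub>R e" for f :: "'a \<Rightarrow> nat" and z
  define A where "A f = {\<omega> \<in> space M. \<forall>z\<in>h f ` W. emeasure (\<Phi> \<omega>) (scaled_cell u z) = 0}" for f
  have finI: "finite I" unfolding I_def by (intro finite_PiE W(1)) auto
  have hW: "finite (h f ` W)" "h f ` W \<subseteq> lattice" for f
    using W fine_cell_lattice[OF e] by (auto simp: h_def)
  have A_meas: "A f \<in> sets M" for f
  proof -
    have "A f = space M - (\<Union>z\<in>h f ` W. {\<omega> \<in> space M. emeasure (\<Phi> \<omega>) (scaled_cell u z) \<noteq> 0})"
      by (auto simp: A_def)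
    moreover have "{\<omega> \<in> space M. emeasure (\<Phi> \<omega>) (scaled_cell u z) \<noteq> 0} \<in> sets M" if "z \<in> h f ` W" for z
      using hW(2) that by (intro occupied_event_measurable[OF pp] scaled_cell_borel u) auto
    ultimately show ?thesis by (simp only:) (intro sets.Diff sets.top sets.finite_UN hW(1))
  qed
  have A_le: "measure M (A f) \<le> exp (- (l * u ^ DIM('a))) ^ card W" if f: "f \<in> I" for f
  proof -
    \<comment> \<open>The selected fine cells are pairwise different, so the exponent
      \<open>card W\<close> is not lost.\<close>
    have "inj_on (h f) W"
    proof (rule inj_onI)
      fix z z' assume "z \<in> W" "z' \<in> W" "h f z = h f z'"
      then show "z = z'"
        using fine_cell_inj[OF e, of z z' "f z" k "f z'"] W(2) f by (auto simp: h_def I_def)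
    qed
    then have "card (h f ` W) = card W" by (rule card_image)
    then show ?thesis
      using prob_all_empty_le[OF pp nu int u hW[of f]] unfolding A_def by simp
  qed
  have "{\<omega> \<in> space M. W \<inter> good_cells e u k (\<Phi> \<omega>) = {}} \<subseteq> (\<Union>f\<in>I. A f)"
  proof clarify
    fix \<omega> assume \<omega>: "\<omega> \<in> space M" "W \<inter> good_cells e u k (\<Phi> \<omega>) = {}"
    have "\<exists>j<k. emeasure (\<Phi> \<omega>) (scaled_cell u (real k *\<^sub>R z + real j *\<^sub>R e)) = 0" if "z \<in> W" for z
      using \<omega>(2) W(2) that by (auto simp: good_cells_def)
    then obtain g where g: "\<And>z. z \<in> W \<Longrightarrow> g z < k"
      "\<And>z. z \<in> W \<Longrightarrow> emeasure (\<Phi> \<omega>) (scaled_cell u (real k *\<^sub>R z + real (g z) *\<^sub>R e)) = 0" by metis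
    have "restrict g W \<in> I" using g(1) by (auto simp: I_def)
    moreover have "\<omega> \<in> A (restrict g W)" using g(2) \<omega>(1) by (auto simp: A_def h_def)
    ultimately show "\<omega> \<in> (\<Union>f\<in>I. A f)" by blast
  qed
  then have "measure M {\<omega> \<in> space M. W \<inter> good_cells e u k (\<Phi> \<omega>) = {}} \<le> measure M (\<Union>f\<in>I. A f)"
    using A_meas by (intro finite_measure_mono sets.finite_UN finI)
  also have "\<dots> \<le> (\<Sum>f\<in>I. measure M (A f))"
    using A_meas by (intro finite_measure_subadditive_finite finI) auto
  also have "\<dots> \<le> (\<Sum>f\<in>I. exp (- (l * u ^ DIM('a))) ^ card W)" by (intro sum_mono A_le)
  also have "\<dots> = real (card I) * exp (- (l * u ^ DIM('a))) ^ card W" by simp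
  also have "real (card I) = real k ^ card W"
    unfolding I_def by (simp add: card_PiE W(1))
  finally show ?thesis by (simp add: power_mult_distrib)
qed

text \<open>Without percolation some bad path must exist, and the expected number of such paths is
  below 1; the contradiction yields positive probability.\<close>

lemma percolation_large_radius:
  fixes \<Phi> :: "'w \<Rightarrow> 'a::euclidean_space measure" and l u :: real
  assumes dim: "2 \<le> DIM('a)" and pp: "point_process M \<Phi>" and nu: "nu_weakly_sub_poisson M \<Phi>"
    and int: "has_intensity M \<Phi> l" and u: "0 < u" and k: "1 \<le> k"
    and small: "card (lattice_steps :: 'a set) * (k * exp (- (l * u ^ DIM('a)))) \<le> 1 / 4"
  shows "0 < measure M {\<omega> \<in> space M. percolates (covered_set k (\<Phi> \<omega>) (real k * u * DIM('a)))}"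
    (is "0 < measure M ?E")
proof (rule ccontr)
  assume "\<not> 0 < measure M ?E"
  interpret prob_space M using pp by (simp add: point_process_def)
  have E: "?E \<in> sets M" by (rule percolation_event_measurable[OF pp])
  have "measure M ?E = 0" using \<open>\<not> 0 < measure M ?E\<close> zero_less_measure_iff[of M ?E] by simp
  then have one: "prob (space M - ?E) = 1" using prob_compl[OF E] by simp
  obtain e :: 'a where e: "e \<in> Basis" using nonempty_Basis by blast
  let ?K = "card (lattice_steps :: 'a set)"
  define q where "q = real k * exp (- (l * u ^ DIM('a)))"
  have q: "0 \<le> q" "real ?K * q \<le> 1 / 4" using small by (simp_all add: q_def)
  \<comment> \<open>A path of \<open>m + 1\<close> cells starts at distance \<open>m\<close> on the
    axis, so the starting point is determined by the length and no separate sum over starts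
    arises.\<close>
  define P where "P m = {p \<in> lattice_paths (Suc m) (real m *\<^sub>R e). distinct p \<and> set p \<subseteq> lattice}" for m
  define F where "F m = (\<Union>p\<in>P m. {\<omega> \<in> space M. set p \<inter> good_cells e u k (\<Phi> \<omega>) = {}})" for m
  have finP: "finite (P m)" for m
    unfolding P_def by (rule finite_subset[OF _ finite_lattice_paths]) blast
  have Bad_meas: "{\<omega> \<in> space M. set p \<inter> good_cells e u k (\<Phi> \<omega>) = {}} \<in> sets M" if "p \<in> P m" for p m
    using that by (intro bad_event_measurable[OF pp e u]) (auto simp: P_def simp del: lattice_paths.simps)
  have F_meas: "F m \<in> sets M" for m
    unfolding F_def by (intro sets.finite_UN finP Bad_meas)
  have F_le: "prob (F m) \<le> (1/4) ^ Suc m" for m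
  proof -
    have "prob (F m) \<le> (\<Sum>p\<in>P m. prob {\<omega> \<in> space M. set p \<inter> good_cells e u k (\<Phi> \<omega>) = {}})"
      unfolding F_def using Bad_meas by (intro finite_measure_subadditive_finite finP) auto
    also have "\<dots> \<le> (\<Sum>p\<in>P m. q ^ Suc m)"
    proof (rule sum_mono)
      fix p assume p: "p \<in> P m"
      then have "distinct p" "set p \<subseteq> lattice" "length p = Suc m"
        by (auto simp: P_def dest: length_lattice_paths simp del: lattice_paths.simps)
      then show "prob {\<omega> \<in> space M. set p \<inter> good_cells e u k (\<Phi> \<omega>) = {}} \<le> q ^ Suc m"
        using prob_all_bad_le[OF pp nu int e u, of "set p" k] by (simp add: q_def distinct_card)
    qed
    also have "\<dots> = real (card (P m)) * q ^ Suc m" by simp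
    also have "\<dots> \<le> real ?K ^ Suc m * q ^ Suc m"
    proof (rule mult_right_mono)
      have "P m \<subseteq> lattice_paths (Suc m) (real m *\<^sub>R e)" by (auto simp: P_def)
      then have "card (P m) \<le> ?K ^ Suc m"
        by (rule order.trans[OF card_mono[OF finite_lattice_paths] card_lattice_paths])
      then show "real (card (P m)) \<le> real ?K ^ Suc m"
        unfolding of_nat_power[symmetric] by (rule of_nat_mono)
    qed (use q(1) in simp)
    also have "\<dots> = (real ?K * q) ^ Suc m" by (simp add: power_mult_distrib)
    also have "\<dots> \<le> (1/4) ^ Suc m" using q by (intro power_mono) auto
    finally show ?thesis .
  qed
  \<comment> \<open>The bound \<open>1 / 4\<close> in the hypothesis makes the total 1/3, safely
    below 1.\<close>
  have sums: "(\<lambda>m. (1/4::real) ^ Suc m) sums (1/3)"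
    using sums_mult[OF geometric_sums[of "1/4::real"], of "1/4"] by simp
  have sF: "summable (\<lambda>m. prob (F m))"
    by (rule summable_comparison_test'[OF sums_summable[OF sums], of 0]) (use F_le in auto)
  have "space M - ?E \<subseteq> (\<Union>m. F m)"
  proof clarify
    fix \<omega> assume \<omega>: "\<omega> \<in> space M" "\<omega> \<notin> (\<Union>m. F m)"
    let ?V = "good_cells e u k (\<Phi> \<omega>)"
    have "percolates (\<Union>z\<in>?V. unit_cell z)"
    proof (rule ccontr)
      assume "\<not> ?thesis"
      moreover have "?V \<subseteq> lattice" by (auto simp: good_cells_def)
      ultimately obtain m p where "p \<in> lattice_paths (Suc m) (real m *\<^sub>R e)" "distinct p" "set p \<subseteq> lattice - ?V"
        using bounded_cluster_bad_path[OF dim _ e] by blast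
      then have "\<omega> \<in> F m" unfolding F_def P_def using \<omega>(1) by (intro UN_I[of p]) auto
      then show False using \<omega>(2) by blast
    qed
    then show "percolates (covered_set k (\<Phi> \<omega>) (real k * u * DIM('a)))"
      by (rule percolates_good_cells_covered[OF point_process_radon[OF pp \<omega>(1)] e u k])
  qed
  then have "prob (space M - ?E) \<le> prob (\<Union>m. F m)"
    using F_meas by (intro finite_measure_mono) auto
  also have "\<dots> \<le> (\<Sum>m. prob (F m))"
    using F_meas by (intro finite_measure_subadditive_countably sF) auto
  also have "\<dots> \<le> (\<Sum>m. (1/4) ^ Suc m)"
    by (intro suminf_le F_le sF sums_summable[OF sums])
  also have "\<dots> = 1 / 3" by (rule sums_unique[OF sums, symmetric])
  finally show False using one by simp
qed

section \<open>Choice of the scales and comparison of the radii\<close>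

section \<open>Critical radii\<close>

text \<open>Restricting to \<open>s \<le> 1\<close> gives \<open>s ^ d \<le> s\<close>, so solving
  the linear inequality suffices.\<close>

lemma ex_subcritical_scale:
  fixes l K :: real
  assumes "0 < l" "0 < K" "1 \<le> d"
  shows "\<exists>s>0. K * (l * s ^ d) \<le> 1 / 2"
proof -
  define s where "s = min 1 (1 / (2 * K * l))"
  have s: "0 < s" "s \<le> 1" "s \<le> 1 / (2 * K * l)" using assms by (auto simp: s_def)
  have "s ^ d \<le> s" using power_decreasing[OF assms(3), of s] s by simp
  then have "K * (l * s ^ d) \<le> K * (l * (1 / (2 * K * l)))"
    using assms s by (intro mult_left_mono) auto
  also have "\<dots> = 1 / 2" using assms by simp
  finally show ?thesis using s(1) by blast
qed

text \<open>Dually, \<open>u \<ge> 1\<close> gives \<open>u \<le> u ^ d\<close>, and the logarithm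
  solves the case of exponent 1.\<close>

lemma ex_supercritical_scale:
  fixes l K :: real
  assumes "0 < l" "0 < K" "1 \<le> d"
  shows "\<exists>u>0. K * exp (- (l * u ^ d)) \<le> 1 / 4"
proof -
  define u where "u = max 1 (ln (4 * K) / l)"
  have u: "1 \<le> u" "ln (4 * K) / l \<le> u" by (auto simp: u_def)
  have "u \<le> u ^ d" using power_increasing[OF assms(3) u(1)] by simp
  then have "l * u \<le> l * u ^ d" using assms(1) by (intro mult_left_mono) auto
  moreover have "ln (4 * K) \<le> l * u" using u(2) assms(1) by (simp add: field_simps)
  ultimately have "exp (- (l * u ^ d)) \<le> exp (- ln (4 * K))" by simp
  also have "\<dots> = 1 / (4 * K)" using assms(2) by (simp add: exp_minus inverse_eq_divide)
  finally have "K * exp (- (l * u ^ d)) \<le> K * (1 / (4 * K))"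
    using assms(2) by (intro mult_left_mono) auto
  also have "\<dots> = 1 / 4" using assms(2) by simp
  finally show ?thesis using u(1) by (intro exI[of _ u]) auto
qed

text \<open>Covered sets decrease in the multiplicity. Passing to probabilities uses measurability
  of the percolation event, since \<open>measure\<close> is monotone only into measurable
  sets.\<close>

lemma critical_radius_mono:
  assumes pp: "point_process M \<Phi>" and "i \<le> j"
  shows "critical_radius i M \<Phi> \<le> critical_radius j M \<Phi>"
proof -
  interpret prob_space M using pp by (simp add: point_process_def)
  have "measure M {\<omega> \<in> space M. percolates (covered_set j (\<Phi> \<omega>) r)} \<le>
      measure M {\<omega> \<in> space M. percolates (covered_set i (\<Phi> \<omega>) r)}" for r
  proof (intro finite_measure_mono percolation_event_measurable[OF pp])
    have "covered_set j \<mu> r \<subseteq> covered_set i \<mu> r" for \<mu> :: "'b measure"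
      using \<open>i \<le> j\<close> unfolding covered_set_def by (auto intro: order.trans[of "of_nat i" "of_nat j"])
    then show "{\<omega> \<in> space M. percolates (covered_set j (\<Phi> \<omega>) r)} \<subseteq>
        {\<omega> \<in> space M. percolates (covered_set i (\<Phi> \<omega>) r)}"
      unfolding percolates_def by blast
  qed
  then show ?thesis
    unfolding critical_radius_def by (intro Inf_superset_mono) (auto intro: less_le_trans)
qed

theorem corollary1p3:
  assumes "DIM('a::euclidean_space) \<ge> 2"
  shows "\<exists>(c :: real \<Rightarrow> real) (C :: real \<Rightarrow> nat \<Rightarrow> real). \<forall>l>0. \<forall>k\<ge>1.
           0 < c l \<and>
           (\<forall>(M :: 'w measure) (\<Phi> :: 'w \<Rightarrow> 'a measure).
              point_process M \<Phi> \<and> simple_pp M \<Phi> \<and> stationary_pp M \<Phi> \<and>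
              weakly_sub_poisson M \<Phi> \<and> has_intensity M \<Phi> l \<longrightarrow>
              ereal (c l) \<le> critical_radius 1 M \<Phi> \<and>
              critical_radius 1 M \<Phi> \<le> critical_radius k M \<Phi> \<and>
              critical_radius k M \<Phi> \<le> ereal (C l k))"
proof -
  let ?K = "real (card (lattice_steps :: 'a set))" and ?d = "DIM('a)"
  have K: "0 < ?K" using card_lattice_steps_pos[where 'a='a] by simp
  have d: "1 \<le> ?d" using assms by simp
  \<comment> \<open>The guard \<open>0 < l\<close> makes the choice total in \<open>l\<close>; the
    scale depends on intensity and dimension, never on the process.\<close>
  have "\<forall>l. \<exists>s. 0 < l \<longrightarrow> 0 < s \<and> ?K * (l * s ^ ?d) \<le> 1 / 2"
    using ex_subcritical_scale[OF _ K d] by blast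
  from choice[OF this] obtain s where s: "\<And>l. 0 < l \<Longrightarrow> 0 < s l \<and> ?K * (l * s l ^ ?d) \<le> 1 / 2"
    by blast
  have "\<exists>u. 0 < l \<longrightarrow> 1 \<le> k \<longrightarrow> 0 < u \<and> ?K * (real k * exp (- (l * u ^ ?d))) \<le> 1 / 4" for l and k :: nat
  proof (cases "0 < l \<and> 1 \<le> k")
    case True
    then show ?thesis using ex_supercritical_scale[of l "?K * real k" ?d] K d by (auto simp: mult.assoc)
  qed auto
  then obtain u where u: "\<And>l k. 0 < l \<Longrightarrow> 1 \<le> k \<Longrightarrow>
      0 < u l k \<and> ?K * (real k * exp (- (l * u l k ^ ?d))) \<le> 1 / 4" by metis
  show ?thesis
  \<comment> \<open>Half the side length is the threshold below which \<open>2 * r < s l\<close>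
    rules out percolation; the upper constant is the covering radius obtained from good
    cells.\<close>
  proof (intro exI[of _ "\<lambda>l. s l / 2"] exI[of _ "\<lambda>l k. real k * u l k * ?d"] allI impI conjI; (elim conjE)?)
    fix l :: real assume "0 < l"
    then show "0 < s l / 2" using s by simp
  next
    fix l :: real and k :: nat and M :: "'w measure" and \<Phi> :: "'w \<Rightarrow> 'a measure"
    assume l: "0 < l" and k: "1 \<le> k" and pp: "point_process M \<Phi>"
      and wsp: "weakly_sub_poisson M \<Phi>" and int: "has_intensity M \<Phi> l"
    from wsp have alpha: "alpha_weakly_sub_poisson M \<Phi>" and nu: "nu_weakly_sub_poisson M \<Phi>"
      by (simp_all add: weakly_sub_poisson_def)
    show "critical_radius 1 M \<Phi> \<le> critical_radius k M \<Phi>" by (rule critical_radius_mono[OF pp k])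
    show "ereal (s l / 2) \<le> critical_radius 1 M \<Phi>"
      unfolding critical_radius_def
    proof (rule Inf_greatest, clarify)
      fix r assume r: "0 \<le> r" "0 < measure M {\<omega> \<in> space M. percolates (covered_set 1 (\<Phi> \<omega>) r)}"
      show "ereal (s l / 2) \<le> ereal r"
      proof (rule ccontr)
        assume "\<not> ?thesis"
        then have "2 * r < s l" by simp
        then show False
          using no_percolation_small_radius[OF pp alpha int r(1), of "s l"] s[OF l] r(2) by simp
      qed
    qed
    have "0 < measure M {\<omega> \<in> space M. percolates (covered_set k (\<Phi> \<omega>) (real k * u l k * ?d))}"
      using percolation_large_radius[OF assms pp nu int _ k] u[OF l k] by blast
    moreover have "0 \<le> real k * u l k * ?d" using u[OF l k] by simp
    ultimately show "critical_radius k M \<Phi> \<le> ereal (real k * u l k * ?d)"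
      unfolding critical_radius_def by (intro Inf_lower) blast
  qed
qed

end
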